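(* Let $h\colon\mathbb R^n\to\mathbb R^k$ be differentiable almost everywhere in the ordinary sense, and let $f\colon\mathbb R^k\to\mathbb R^m$ be pointwise Lipschitz. Then, for almost every $x\in\mathbb R^n$, $f\circ h$ is differentiable in the ordinary sense at $x$ and $$(f\circ h)'(x;u)=f'\bigl(h(x);h'(x;u)\bigr)\qquad\text{for all }u\in\mathbb R^n$$ (in particular, the directional derivatives of $f$ on the right-hand side exist). In particular, for almost every $x\in\mathbb R^n$, $$\frac{\partial (f(h(x)))}{\partial x_i}=f'\Bigl(h(x);\frac{\partial h(x)}{\partial x_i}\Bigr),\qquad i=1,\dots,n.$$
   Context: "Almost everywhere" refers to Lebesgue measure on $\mathbb R^n$. "Differentiable in the ordinary sense" means Fréchet differentiable. $f'(y;v)=\lim_{t\to0}\frac{f(y+tv)-f(y)}{t}$ denotes the (two-sided) directional derivative. $f\colon\mathbb R^k\to\mathbb R^m$ is pointwise Lipschitz if $\limsup_{x\to y}\|f(x)-f(y)\|/\|x-y\|<\infty$ for every $y\in\mathbb R^k$. *)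

theory Defs
  imports "HOL-Analysis.Analysis"
begin

text \<open>The limit superior is taken in the extended reals, over the punctured neighbourhoods of \<open>y\<close>.\<close>

definition pointwise_lipschitz :: "('a::real_normed_vector \<Rightarrow> 'b::real_normed_vector) \<Rightarrow> bool"
  where "pointwise_lipschitz f \<longleftrightarrow>
    (\<forall>y. Limsup (at y) (\<lambda>x. ereal (norm (f x - f y) / norm (x - y))) < \<infinity>)"

definition has_dir_deriv ::
    "('a::real_normed_vector \<Rightarrow> 'b::real_normed_vector) \<Rightarrow> 'a \<Rightarrow> 'a \<Rightarrow> 'b \<Rightarrow> bool"
  where "has_dir_deriv f y v d \<longleftrightarrow>
    ((\<lambda>t::real. (f (y + t *\<^sub>R v) - f y) /\<^sub>R t) \<longlongrightarrow> d) (at 0)"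

definition dir_differentiable ::
    "('a::real_normed_vector \<Rightarrow> 'b::real_normed_vector) \<Rightarrow> 'a \<Rightarrow> 'a \<Rightarrow> bool"
  where "dir_differentiable f y v \<longleftrightarrow> (\<exists>d. has_dir_deriv f y v d)"

text \<open>\<open>dir_deriv f y v\<close> is an unspecified value if the limit does not exist, so equations between
  directional derivatives are to be accompanied by \<^const>\<open>dir_differentiable\<close>; similarly for
  \<open>partial_deriv\<close> and \<open>partially_differentiable\<close> below.\<close>

definition dir_deriv ::
    "('a::real_normed_vector \<Rightarrow> 'b::real_normed_vector) \<Rightarrow> 'a \<Rightarrow> 'a \<Rightarrow> 'b"
  where "dir_deriv f y v = Lim (at 0) (\<lambda>t::real. (f (y + t *\<^sub>R v) - f y) /\<^sub>R t)"

definition coord_section :: "(real ^ 'n \<Rightarrow> 'b) \<Rightarrow> real ^ 'n \<Rightarrow> 'n \<Rightarrow> real \<Rightarrow> 'b"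
  where "coord_section g x i = (\<lambda>s. g (\<chi> j. if j = i then s else x $ j))"

definition partially_differentiable ::
    "(real ^ 'n \<Rightarrow> 'b::real_normed_vector) \<Rightarrow> real ^ 'n \<Rightarrow> 'n \<Rightarrow> bool"
  where "partially_differentiable g x i \<longleftrightarrow> coord_section g x i differentiable (at (x $ i))"

definition partial_deriv ::
    "(real ^ 'n \<Rightarrow> 'b::real_normed_vector) \<Rightarrow> real ^ 'n \<Rightarrow> 'n \<Rightarrow> 'b"
  where "partial_deriv g x i = vector_derivative (coord_section g x i) (at (x $ i))"

end

theory Submission
  imports Defs
begin

text \<open>A real function with \<open>limsup \<bar>g z - g x\<bar> / \<bar>z - x\<bar>\<close> finite at \<open>x\<close> is squeezed near \<open>x\<close>, with equality
  at \<open>x\<close>, between two globally Lipschitz functions taken from a fixed countable family: the largest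
  \<open>n\<close>-Lipschitz minorant and the smallest \<open>n\<close>-Lipschitz majorant of \<open>g\<close> on a basic open set (Maly's
  proof of Stepanov's theorem). Let \<open>l \<le> f \<le> u\<close> be such envelopes of a component of \<open>f\<close> near \<open>h x\<close>.
  By Stepanov's theorem \<open>l \<circ> h\<close> and \<open>u \<circ> h\<close> are differentiable at almost every \<open>x\<close>, and their
  derivatives agree because \<open>u \<circ> h - l \<circ> h\<close> has a minimum at \<open>x\<close>. This squeezes \<open>f \<circ> h\<close>; and
  since \<open>l\<close> and \<open>u\<close>, unlike \<open>f\<close>, are Lipschitz near \<open>h x\<close>, their increments along the line
  \<open>h x + t h'(x;u)\<close> and along the curve \<open>h (x + t u)\<close> differ by \<open>o(t)\<close>, so that \<open>f\<close> is squeezed along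
  the line as well.

  Rademacher's theorem is reduced to the real line. Directional derivatives exist almost everywhere by
  Fubini. For additivity, the distance to a set \<open>A\<close> is Lipschitz, so at almost every point of \<open>A\<close>
  it has a directional derivative, necessarily \<open>0\<close>; hence there are points of \<open>A\<close> at distance \<open>o(t)\<close> from
  \<open>x + t u\<close>. This is applied to countably many sets \<open>A\<close> on which the difference quotients in
  direction \<open>v\<close> are almost constant. On the line, Vitali's covering theorem is used.\<close>

section \<open>Derivatives of Lipschitz functions on the line\<close>

lemma emeasure_interval_measure_Ioo:
  fixes F :: "real \<Rightarrow> real"
  assumes "a \<le> b" "mono F" "continuous_on UNIV F"
  shows "emeasure (interval_measure F) {a<..<b} = F b - F a"
proof (cases "a = b")
  case False
  have mono: "\<And>x y. x \<le> y \<Longrightarrow> F x \<le> F y"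
    using assms(2) by (simp add: monoD)
  have rc: "\<And>x. continuous (at_right x) F"
    using assms(3) continuous_at_imp_continuous_within continuous_on_eq_continuous_at by blast
  have "emeasure (interval_measure F) {b..b} = F b - F b"
    by (rule emeasure_interval_measure_Icc[OF _ mono assms(3)]) auto
  then have pt: "{b} \<in> null_sets (interval_measure F)"
    by (auto simp: null_sets_def)
  have "{a<..<b} = {a<..b} - {b}"
    using assms(1) by auto
  then have "emeasure (interval_measure F) {a<..<b} = emeasure (interval_measure F) {a<..b}"
    using emeasure_Diff_null_set[OF pt, of "{a<..b}"] by simp
  also have "\<dots> = F b - F a"
    by (rule emeasure_interval_measure_Ioc[OF assms(1) mono rc])
  finally show ?thesis .
qed simp

text \<open>A form of Vitali's theorem in which the balls need only contain the point and stay
  inside \<open>U\<close>, so that the measure of their union is controlled by that of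
  \<open>U\<close>.\<close>

lemma Vitali_balls_inside_open:
  fixes S U :: "'a::euclidean_space set"
  assumes "open U" "S \<subseteq> U"
    and small: "\<And>x d. x \<in> S \<Longrightarrow> d > 0 \<Longrightarrow> \<exists>c r. x \<in> ball c r \<and> r < d \<and> P c r"
  obtains C where "countable C" "\<And>i. i \<in> C \<Longrightarrow> P (fst i) (snd i) \<and> ball (fst i) (snd i) \<subseteq> U"
    "disjoint_family_on (\<lambda>i. ball (fst i) (snd i)) C"
    "negligible (S - (\<Union>i\<in>C. ball (fst i) (snd i)))"
proof -
  define K where "K = {i. P (fst i) (snd i) \<and> ball (fst i) (snd i) \<subseteq> U}"
  have K: "\<exists>i. i \<in> K \<and> x \<in> ball (fst i) (snd i) \<and> snd i < d" if x: "x \<in> S" and d: "d > 0" for x d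
  proof -
    obtain e where e: "e > 0" "ball x e \<subseteq> U"
      using assms x openE by blast
    \<comment> \<open>A ball of radius below \<open>e / 2\<close> that contains \<open>x\<close>
      lies in \<open>ball x e\<close>, wherever its centre is.\<close>
    obtain c r where cr: "x \<in> ball c r" "r < min d (e/2)" "P c r"
      using small[OF x, of "min d (e/2)"] d e by auto
    have "ball c r \<subseteq> ball x e"
    proof
      fix y assume "y \<in> ball c r"
      then have "dist x y < r + r"
        using cr(1) dist_triangle[of x y c] by (simp add: dist_commute)
      then show "y \<in> ball x e" using cr(2) by simp
    qed
    with cr e show ?thesis
      by (intro exI[of _ "(c, r)"]) (auto simp: K_def)
  qed
  obtain C where C: "countable C" "C \<subseteq> K"
     "pairwise (\<lambda>i j. disjnt (ball (fst i) (snd i)) (ball (fst j) (snd j))) C"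
     "negligible(S - (\<Union>i \<in> C. ball (fst i) (snd i)))"
    using Vitali_covering_theorem_balls[where a=fst and r=snd, OF K] by blast
  have "disjoint_family_on (\<lambda>i. ball (fst i) (snd i)) C"
    using C(3) by (auto simp: disjoint_family_on_def pairwise_def disjnt_def)
  with C show ?thesis
    by (intro that[of C]) (auto simp: K_def)
qed

lemma emeasure_Diff_null_le:
  assumes "S - V \<in> null_sets M" "V \<in> sets M"
  shows "emeasure M S \<le> emeasure M V"
proof (cases "S \<in> sets M")
  case True
  have "emeasure M S = emeasure M (S - (S - V))"
    using emeasure_Diff_null_set[OF assms(1) True] by simp
  also have "\<dots> \<le> emeasure M V"
    using assms(2) by (intro emeasure_mono) auto
  finally show ?thesis .
\<comment> \<open>A nonmeasurable \<open>S\<close> has \<open>emeasure\<close> 0 by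
  convention.\<close>
qed (simp add: emeasure_notin_sets)

text \<open>The Stieltjes measure of \<open>F\<close> is compared with Lebesgue measure on two
  nested Vitali covers. Balls of small slope inside an open \<open>U\<close> around \<open>S\<close>
  have total Stieltjes measure at most \<open>p\<close> times the measure of \<open>U\<close>; balls
  of large slope inside the first cover have at least \<open>q\<close> times the measure of
  \<open>S\<close>. With \<open>U\<close> close to \<open>S\<close> in measure, this contradicts
  \<open>p < q\<close> unless \<open>S\<close> is null.\<close>

lemma null_set_of_distinct_slopes:
  fixes F :: "real \<Rightarrow> real" and S :: "real set"
  assumes F: "mono F" "continuous_on UNIV F" and "p < q" and S: "S \<in> sets borel" "bounded S"
    and small: "\<And>x d. x \<in> S \<Longrightarrow> d > 0 \<Longrightarrow> \<exists>c r. x \<in> ball c r \<and> r < d \<and> F (c + r) - F (c - r) \<le> p * (2 * r)"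
    and large: "\<And>x d. x \<in> S \<Longrightarrow> d > 0 \<Longrightarrow> \<exists>c r. x \<in> ball c r \<and> r < d \<and> F (c + r) - F (c - r) \<ge> q * (2 * r)"
  shows "S \<in> null_sets lborel"
proof (cases "S = {}")
  case False
  \<comment> \<open>A single ball of small slope forces \<open>p \<ge> 0\<close>, because
    \<open>F\<close> is monotone. This allows \<open>p\<close> and \<open>q\<close> to be used as
    factors in \<open>ennreal\<close>.\<close>
  then obtain x c r where "x \<in> ball c r" and cr: "F (c + r) - F (c - r) \<le> p * (2 * r)"
    using small[of _ 1] by (metis ex_in_conv zero_less_one)
  then have r: "r > 0"
    by (metis le_less_trans mem_ball zero_le_dist)
  have "F (c - r) \<le> F (c + r)"
    using r by (intro monoD[OF F(1)]) auto
  with cr have "0 \<le> p * (2 * r)" by linarith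
  with r have "p \<ge> 0"
    by (simp add: zero_le_mult_iff)
  with \<open>p < q\<close> have q: "q > 0" by simp
  let ?\<mu> = "interval_measure F"
  have ball_real: "ball c r = {c - r<..<c + r}" for c r :: real
    by (rule ball_eq_greaterThanLessThan)
  \<comment> \<open>Vitali's theorem does not restrict the sign of the radii; balls of negative
    radius are empty.\<close>
  have \<mu>: "emeasure ?\<mu> (ball c r) = (if r \<ge> 0 then F (c + r) - F (c - r) else 0)" for c r
    using emeasure_interval_measure_Ioo[OF _ F, of "c - r" "c + r"] unfolding ball_real by auto
  have \<lambda>: "emeasure lborel (ball c r) = (if r \<ge> 0 then 2 * r else 0)" for c r :: real
    unfolding ball_real by auto
  have neg_null: "A \<in> null_sets lborel \<longleftrightarrow> negligible A" if "A \<in> sets borel" for A :: "real set"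
    using that by (simp add: negligible_iff_null_sets null_sets_completion_iff)
  have fin: "emeasure lborel S < \<infinity>"
    using emeasure_bounded_finite[OF S(2)] by simp
  have bound: "ennreal q * emeasure lborel S \<le> ennreal p * (emeasure lborel S + ennreal e)" if "e > 0" for e
  proof -
    obtain U where U: "open U" "S \<subseteq> U" "emeasure lborel (U - S) < e"
      using outer_regular_lborel[OF S(1) \<open>e > 0\<close>] .
    have US: "emeasure lborel U \<le> emeasure lborel S + e"
    proof -
      have "emeasure lborel U = emeasure lborel (S \<union> (U - S))"
        using U by (intro arg_cong2[where f=emeasure]) auto
      also have "\<dots> \<le> emeasure lborel S + emeasure lborel (U - S)"
        using U S by (intro emeasure_subadditive) auto
      also have "\<dots> \<le> emeasure lborel S + e"
        using U(3) by (intro add_mono) auto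
      finally show ?thesis .
    qed
    obtain C where C: "countable C" 
      "\<And>i. i \<in> C \<Longrightarrow> F (fst i + snd i) - F (fst i - snd i) \<le> p * (2 * snd i) \<and> ball (fst i) (snd i) \<subseteq> U"
      "disjoint_family_on (\<lambda>i. ball (fst i) (snd i)) C"
      "negligible (S - (\<Union>i\<in>C. ball (fst i) (snd i)))"
      using Vitali_balls_inside_open[OF U(1,2) small] by blast
    let ?V = "\<Union>i\<in>C. ball (fst i) (snd i)"
    have "emeasure ?\<mu> ?V = (\<integral>\<^sup>+i. emeasure ?\<mu> (ball (fst i) (snd i)) \<partial>count_space C)"
      using C by (intro emeasure_UN_countable) auto
    also have "\<dots> \<le> (\<integral>\<^sup>+i. ennreal p * emeasure lborel (ball (fst i) (snd i)) \<partial>count_space C)"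
    proof (intro nn_integral_mono)
      fix i assume "i \<in> space (count_space C)"
      then show "emeasure ?\<mu> (ball (fst i) (snd i)) \<le> ennreal p * emeasure lborel (ball (fst i) (snd i))"
        unfolding \<mu> \<lambda> using C(2)[of i] \<open>p \<ge> 0\<close>
        by (auto simp: ennreal_mult[symmetric] intro!: ennreal_leI)
    qed
    also have "\<dots> = ennreal p * emeasure lborel ?V"
      using C by (subst emeasure_UN_countable) (auto simp: nn_integral_cmult)
    also have "\<dots> \<le> ennreal p * emeasure lborel U"
      using C(2) U by (intro mult_left_mono emeasure_mono) auto
    finally have *: "emeasure ?\<mu> ?V \<le> ennreal p * emeasure lborel U" .
    have oV: "open ?V" by auto
    \<comment> \<open>The second cover is taken inside \<open>?V\<close>, which makes its Stieltjes
      measure at most that of \<open>?V\<close>. Almost nothing of \<open>S\<close> is lost, since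
      \<open>S - ?V\<close> is negligible.\<close>
    have large': "\<exists>c r. x \<in> ball c r \<and> r < d \<and> F (c + r) - F (c - r) \<ge> q * (2 * r)"
      if "x \<in> S \<inter> ?V" "d > 0" for x d
      using large that by blast
    obtain D where D: "countable D" 
      "\<And>i. i \<in> D \<Longrightarrow> F (fst i + snd i) - F (fst i - snd i) \<ge> q * (2 * snd i) \<and> ball (fst i) (snd i) \<subseteq> ?V"
      "disjoint_family_on (\<lambda>i. ball (fst i) (snd i)) D"
      "negligible ((S \<inter> ?V) - (\<Union>i\<in>D. ball (fst i) (snd i)))"
      using Vitali_balls_inside_open[OF oV Int_lower2 large'] by blast
    let ?W = "\<Union>i\<in>D. ball (fst i) (snd i)"
    have "negligible (S - ?W)"
      by (rule negligible_subset[OF negligible_Un[OF C(4) D(4)]]) auto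
    then have "S - ?W \<in> null_sets lborel"
      by (intro iffD2[OF neg_null] sets.Diff[OF S(1)] borel_open) auto
    then have "ennreal q * emeasure lborel S \<le> ennreal q * emeasure lborel ?W"
      by (intro mult_left_mono emeasure_Diff_null_le) (auto intro!: borel_open)
    also have "\<dots> = (\<integral>\<^sup>+i. ennreal q * emeasure lborel (ball (fst i) (snd i)) \<partial>count_space D)"
      using D by (subst emeasure_UN_countable) (auto simp: nn_integral_cmult)
    also have "\<dots> \<le> (\<integral>\<^sup>+i. emeasure ?\<mu> (ball (fst i) (snd i)) \<partial>count_space D)"
    proof (intro nn_integral_mono)
      fix i assume "i \<in> space (count_space D)"
      then show "ennreal q * emeasure lborel (ball (fst i) (snd i)) \<le> emeasure ?\<mu> (ball (fst i) (snd i))"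
        unfolding \<mu> \<lambda> using D(2)[of i] q
        by (auto simp: ennreal_mult[symmetric] intro!: ennreal_leI)
    qed
    also have "\<dots> = emeasure ?\<mu> ?W"
      using D by (intro emeasure_UN_countable[symmetric]) auto
    also have "\<dots> \<le> emeasure ?\<mu> ?V"
      using D(2) by (intro emeasure_mono) (auto intro!: borel_open)
    also have "\<dots> \<le> ennreal p * emeasure lborel U" by (rule *)
    also have "\<dots> \<le> ennreal p * (emeasure lborel S + ennreal e)"
      using US by (intro mult_left_mono) auto
    finally show ?thesis .
  qed
  \<comment> \<open>Finiteness, from the boundedness of \<open>S\<close>, permits subtraction; then
    \<open>e\<close> tends to 0.\<close>
  obtain s where s: "emeasure lborel S = ennreal s" "s \<ge> 0"
    using fin by (cases "emeasure lborel S") auto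
  have "q * s \<le> p * (s + e)" if "e > 0" for e
    using bound[OF that] that s q \<open>p \<ge> 0\<close>
    by (simp add: ennreal_mult[symmetric] ennreal_plus[symmetric] del: ennreal_plus)
  then have "q * s - p * s \<le> p * e" if "e > 0" for e
    using that by (simp add: algebra_simps)
  then have "((\<lambda>e. p * e) \<longlongrightarrow> 0) (at_right 0) \<Longrightarrow> q * s - p * s \<le> 0"
    by (intro tendsto_lowerbound[of _ 0 "at_right 0"]) (auto simp: eventually_at_right_less eventually_at_filter)
  moreover have "((\<lambda>e. p * e) \<longlongrightarrow> 0) (at_right 0)"
    by (auto intro!: tendsto_eq_intros)
  ultimately have "(q - p) * s \<le> 0" by (simp add: algebra_simps)
  then have "s = 0"
    using s \<open>p < q\<close> by (simp add: mult_le_0_iff)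
  with s S show ?thesis by (auto simp: null_sets_def)
qed simp

section \<open>From slopes of intervals to derivatives\<close>

text \<open>A difference quotient at \<open>x\<close> belongs to an interval with \<open>x\<close>
  as an endpoint, whereas the covers consist of open balls. By continuity a strict slope bound
  survives a slight enlargement of the interval.\<close>

lemma enlarge_interval_small_slope:
  fixes F :: "real \<Rightarrow> real"
  assumes "continuous_on UNIV F" "a < b" "F b - F a < p * (b - a)" "b - a < d"
  shows "\<exists>c r. {a..b} \<subseteq> ball c r \<and> r < d \<and> F (c + r) - F (c - r) < p * (2 * r)"
proof -
  have cont: "isCont F x" for x
    using assms(1) continuous_on_eq_continuous_at by blast
  have "((\<lambda>e. p * (b - a + 2 * e) - (F (b + e) - F (a - e))) \<longlongrightarrow> p * (b - a + 2 * 0) - (F (b + 0) - F (a - 0))) (at_right 0)"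
    by (intro tendsto_intros isCont_tendsto_compose[OF cont])
  then have "eventually (\<lambda>e. p * (b - a + 2 * e) - (F (b + e) - F (a - e)) > 0) (at_right 0)"
    using assms by (intro order_tendstoD) auto
  moreover have "eventually (\<lambda>e::real. e < (d - (b - a)) / 2) (at_right 0)"
    using assms by (intro eventually_at_right_less order_tendstoD[OF tendsto_ident_at]) auto
  moreover have "eventually (\<lambda>e::real. e > 0) (at_right 0)"
    by (rule eventually_at_right_less)
  ultimately have "eventually (\<lambda>e. p * (b - a + 2 * e) - (F (b + e) - F (a - e)) > 0 \<and> e < (d - (b - a)) / 2 \<and> e > 0) (at_right 0)"
    by eventually_elim auto
  then obtain e where e: "p * (b - a + 2 * e) - (F (b + e) - F (a - e)) > 0" "e < (d - (b - a)) / 2" "e > 0"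
    using eventually_happens'[OF trivial_limit_at_right_real] by blast
  define c r where "c = (a + b) / 2" and "r = (b - a) / 2 + e"
  have cr: "c + r = b + e" "c - r = a - e" "2 * r = b - a + 2 * e"
    by (auto simp: c_def r_def field_simps)
  show ?thesis
  proof (intro exI conjI)
    show "{a..b} \<subseteq> ball c r"
      using e cr by (auto simp: ball_eq_greaterThanLessThan)
    show "r < d" using e assms by (auto simp: r_def field_simps)
    show "F (c + r) - F (c - r) < p * (2 * r)" using e unfolding cr by simp
  qed
qed

lemma not_eventually_at_0_real:
  fixes P :: "real \<Rightarrow> bool"
  assumes "\<not> eventually P (at 0)" "e > 0"
  obtains t where "t \<noteq> 0" "\<bar>t\<bar> < e" "\<not> P t"
  using assms unfolding eventually_at by (metis dist_0_norm dist_commute real_norm_def)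

text \<open>If the limit inferior were below the limit superior, two rationals would fit strictly
  between them and violate \<open>no_gap\<close>. Boundedness makes the common value finite.\<close>

lemma bounded_slopes_limit:
  fixes s :: "real \<Rightarrow> real"
  assumes bound: "\<And>t. \<bar>s t\<bar> \<le> L"
    and no_gap: "\<And>p q. p \<in> \<rat> \<Longrightarrow> q \<in> \<rat> \<Longrightarrow> p < q \<Longrightarrow>
      (\<forall>\<^sub>F t in at 0. s t \<ge> p) \<or> (\<forall>\<^sub>F t in at 0. s t \<le> q)"
  shows "\<exists>d. (s \<longlongrightarrow> d) (at 0)"
proof -
  let ?l = "Liminf (at 0) (\<lambda>t. ereal (s t))" and ?u = "Limsup (at 0) (\<lambda>t. ereal (s t))"
  have le: "?l \<le> ?u" by (intro Liminf_le_Limsup) auto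
  have "\<not> ?l < ?u"
  proof
    assume "?l < ?u"
    then obtain p0 where p0: "?l < ereal p0" "ereal p0 < ?u" using ereal_dense2 by blast
    then obtain q0 where q0: "ereal p0 < ereal q0" "ereal q0 < ?u" using ereal_dense2 by blast
    then have "p0 < q0" by simp
    then obtain p where p: "p \<in> \<rat>" "p0 < p" "p < q0" using Rats_dense_in_real by blast
    then obtain q where q: "q \<in> \<rat>" "p < q" "q < q0" using Rats_dense_in_real by blast
    from no_gap[OF p(1) q(1) q(2)] show False
    proof
      assume "\<forall>\<^sub>F t in at 0. s t \<ge> p"
      then have "?l \<ge> ereal p" by (intro Liminf_bounded) auto
      then have "ereal p < ereal p0" using p0(1) by (rule le_less_trans)
      with p show False by simp
    next
      assume "\<forall>\<^sub>F t in at 0. s t \<le> q"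
      then have "?u \<le> ereal q" by (intro Limsup_bounded) auto
      with q0(2) have "ereal q0 < ereal q" by (rule less_le_trans)
      with q show False by simp
    qed
  qed
  with le have eq: "?l = ?u" by simp
  have "?l \<ge> ereal (-L)" 
    using bound by (intro Liminf_bounded always_eventually) (auto simp: abs_le_iff minus_le_iff)
  moreover have "?u \<le> ereal L"
    using bound by (intro Limsup_bounded always_eventually) (auto simp: abs_le_iff)
  ultimately obtain d where d: "?l = ereal d" unfolding eq by (cases ?u) auto
  then have "((\<lambda>t. ereal (s t)) \<longlongrightarrow> ereal d) (at 0)"
    using eq by (subst tendsto_iff_Liminf_eq_Limsup) auto
  then show ?thesis by auto
qed

text \<open>Where the quotients have no limit, there are rationals \<open>p < q\<close> such that
  arbitrarily short intervals with endpoint \<open>x\<close> have slope below \<open>p\<close>, and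
  others slope above \<open>q\<close>. Each of the countably many pairs contributes a null
  set.\<close>

lemma mono_lipschitz_AE_derivative:
  fixes F :: "real \<Rightarrow> real"
  assumes "mono F" "L-lipschitz_on UNIV F"
  shows "AE x in lborel. \<exists>d. ((\<lambda>t. (F (x + t) - F x) / t) \<longlongrightarrow> d) (at 0)"
proof -
  have cont: "continuous_on UNIV F" "continuous_on UNIV (\<lambda>x. - F x)"
    using assms(2) lipschitz_on_continuous_on by (auto intro: continuous_intros)
  \<comment> \<open>The balls need not be centred at the point, so \<open>A p\<close> and
    \<open>B q\<close> are countable intersections of open sets, which settles
    measurability.\<close>
  define A where "A p = (\<Inter>n::nat. \<Union>{ball c r |c r. r < 1 / Suc n \<and> F (c + r) - F (c - r) < p * (2 * r)})" for p
  define B where "B q = (\<Inter>n::nat. \<Union>{ball c r |c r. r < 1 / Suc n \<and> F (c + r) - F (c - r) > q * (2 * r)})" for q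
  have A_borel: "A p \<in> sets borel" for p
    unfolding A_def by (rule sets.countable_INT) (auto intro!: borel_open open_Union)
  have B_borel: "B q \<in> sets borel" for q
    unfolding B_def by (rule sets.countable_INT) (auto intro!: borel_open open_Union)
  have null: "A p \<inter> B q \<inter> ball 0 (real n) \<in> null_sets lborel" if "p < q" for p q n
  proof (rule null_set_of_distinct_slopes[OF assms(1) cont(1) that])
    fix x d :: real assume x: "x \<in> A p \<inter> B q \<inter> ball 0 (real n)" and "d > 0"
    then obtain m where m: "1 / Suc m < d" using nat_approx_posE by blast
    from x have "x \<in> \<Union>{ball c r |c r. r < 1 / Suc m \<and> F (c + r) - F (c - r) < p * (2 * r)}"
      unfolding A_def by blast
    then show "\<exists>c r. x \<in> ball c r \<and> r < d \<and> F (c + r) - F (c - r) \<le> p * (2 * r)"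
      using m by (fastforce intro: less_imp_le)
    from x have "x \<in> \<Union>{ball c r |c r. r < 1 / Suc m \<and> F (c + r) - F (c - r) > q * (2 * r)}"
      unfolding B_def by blast
    then show "\<exists>c r. x \<in> ball c r \<and> r < d \<and> F (c + r) - F (c - r) \<ge> q * (2 * r)"
      using m by (fastforce intro: less_imp_le)
  next
    show "A p \<inter> B q \<inter> ball 0 (real n) \<in> sets borel"
      by (intro sets.Int A_borel B_borel borel_open open_ball)
    show "bounded (A p \<inter> B q \<inter> ball 0 (real n))"
      by (rule bounded_subset[OF bounded_ball Int_lower2])
  qed
  define N where "N = (\<Union>p\<in>\<rat>. \<Union>q\<in>\<rat> \<inter> {p<..}. \<Union>n. A p \<inter> B q \<inter> ball 0 (real n))"
  have "N \<in> null_sets lborel"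
    unfolding N_def using null countable_rat by (intro null_sets_UN' countable_Int1) auto
  moreover have "\<exists>d. ((\<lambda>t. (F (x + t) - F x) / t) \<longlongrightarrow> d) (at 0)" if x: "x \<notin> N" for x
  proof (rule bounded_slopes_limit[where L=L])
    fix t show "\<bar>(F (x + t) - F x) / t\<bar> \<le> L"
      using lipschitz_onD[OF assms(2), of "x + t" x] lipschitz_on_nonneg[OF assms(2)]
      by (cases "t = 0") (auto simp: dist_real_def abs_divide divide_le_eq)
  next
    fix p q :: real assume pq: "p \<in> \<rat>" "q \<in> \<rat>" "p < q"
    show "(\<forall>\<^sub>F t in at 0. (F (x + t) - F x) / t \<ge> p) \<or> (\<forall>\<^sub>F t in at 0. (F (x + t) - F x) / t \<le> q)"
    proof (rule ccontr)
      assume "\<not> ?thesis"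
      then have freq: "\<not> (\<forall>\<^sub>F t in at 0. (F (x + t) - F x) / t \<ge> p)" "\<not> (\<forall>\<^sub>F t in at 0. (F (x + t) - F x) / t \<le> q)"
        by auto
      \<comment> \<open>With \<open>min\<close> and \<open>max\<close> both signs of
        \<open>t\<close> are treated at once: the quotient is the slope of \<open>F\<close> over the
        interval between \<open>x\<close> and \<open>x + t\<close>.\<close>
      have endpoints: "F (max x (x + t)) - F (min x (x + t)) = (F (x + t) - F x) / t * (max x (x + t) - min x (x + t))"
        "max x (x + t) - min x (x + t) = \<bar>t\<bar>" "min x (x + t) < max x (x + t)" if "t \<noteq> 0" for t
        using that by (auto simp: max_def min_def)
      have "x \<in> A p"
        unfolding A_def
      proof
        fix n
        obtain t where t: "t \<noteq> 0" "\<bar>t\<bar> < 1 / Suc n" "(F (x + t) - F x) / t < p"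
          using not_eventually_at_0_real[OF freq(1), of "1 / Suc n"] by (auto simp: not_le)
        obtain c r where "{min x (x + t)..max x (x + t)} \<subseteq> ball c r" "r < 1 / Suc n" "F (c + r) - F (c - r) < p * (2 * r)"
        proof (rule exE[OF enlarge_interval_small_slope[OF cont(1), of "min x (x + t)" "max x (x + t)" p "1 / Suc n"]])
          show "F (max x (x + t)) - F (min x (x + t)) < p * (max x (x + t) - min x (x + t))"
            unfolding endpoints(1)[OF t(1)] using endpoints(2)[OF t(1)] t by (intro mult_strict_right_mono) auto
        qed (use endpoints(2,3)[OF t(1)] t in auto)
        then show "x \<in> \<Union>{ball c r |c r. r < 1 / Suc n \<and> F (c + r) - F (c - r) < p * (2 * r)}"
          by (force simp: subset_eq)
      qed
      moreover have "x \<in> B q"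
        unfolding B_def
      proof
        fix n
        obtain t where t: "t \<noteq> 0" "\<bar>t\<bar> < 1 / Suc n" "(F (x + t) - F x) / t > q"
          using not_eventually_at_0_real[OF freq(2), of "1 / Suc n"] by (auto simp: not_le)
        have slope: "F (max x (x + t)) - F (min x (x + t)) > q * (max x (x + t) - min x (x + t))"
          unfolding endpoints(1)[OF t(1)] using endpoints[OF t(1)] t by (intro mult_strict_right_mono) auto
        \<comment> \<open>Slopes of \<open>F\<close> above \<open>q\<close> are slopes of
          \<open>- F\<close> below \<open>- q\<close>.\<close>
        obtain c r where "{min x (x + t)..max x (x + t)} \<subseteq> ball c r" "r < 1 / Suc n" "- F (c + r) - - F (c - r) < - q * (2 * r)"
        proof (rule exE[OF enlarge_interval_small_slope[OF cont(2), of "min x (x + t)" "max x (x + t)" "- q" "1 / Suc n"]])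
          show "- F (max x (x + t)) - - F (min x (x + t)) < - q * (max x (x + t) - min x (x + t))"
            using slope by simp
        qed (use endpoints(2,3)[OF t(1)] t in auto)
        then show "x \<in> \<Union>{ball c r |c r. r < 1 / Suc n \<and> F (c + r) - F (c - r) > q * (2 * r)}"
          by (force simp: subset_eq)
      qed
      moreover obtain n :: nat where "x \<in> ball 0 (real n)"
        using reals_Archimedean2[of "\<bar>x\<bar>"] by auto
      ultimately have "x \<in> N" using pq by (auto simp: N_def)
      with x show False by simp
    qed
  qed
  ultimately show ?thesis
    by (intro AE_I'[of N]) auto
qed

text \<open>Adding \<open>L * x\<close> makes the function monotone and merely shifts all difference
  quotients by \<open>L\<close>.\<close>

lemma lipschitz_AE_derivative:
  fixes f :: "real \<Rightarrow> real"
  assumes "L-lipschitz_on UNIV f"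
  shows "AE x in lborel. \<exists>d. ((\<lambda>t. (f (x + t) - f x) / t) \<longlongrightarrow> d) (at 0)"
proof -
  define F where "F x = f x + L * x" for x
  have "mono F"
  proof
    fix x y :: real assume "x \<le> y"
    then show "F x \<le> F y"
      using lipschitz_onD[OF assms, of x y] by (auto simp: F_def dist_real_def abs_le_iff algebra_simps)
  qed
  moreover have "(L + \<bar>L\<bar> * 1)-lipschitz_on UNIV F"
    unfolding F_def using assms lipschitz_on_cmult_real[OF lipschitz_on_id, of L]
    by (intro lipschitz_on_add) auto
  ultimately have "AE x in lborel. \<exists>d. ((\<lambda>t. (F (x + t) - F x) / t) \<longlongrightarrow> d) (at 0)"
    by (rule mono_lipschitz_AE_derivative)
  then show ?thesis
  proof (rule AE_mp, intro AE_I2 impI)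
    fix x assume "\<exists>d. ((\<lambda>t. (F (x + t) - F x) / t) \<longlongrightarrow> d) (at 0)"
    then obtain d where "((\<lambda>t. (F (x + t) - F x) / t) \<longlongrightarrow> d) (at 0)" ..
    then have "((\<lambda>t. (F (x + t) - F x) / t - L) \<longlongrightarrow> d - L) (at 0)"
      by (intro tendsto_intros)
    moreover have "\<forall>\<^sub>F t in at 0. (F (x + t) - F x) / t - L = (f (x + t) - f x) / t"
      unfolding eventually_at by (intro exI[of _ 1]) (simp add: F_def field_simps)
    ultimately show "\<exists>d. ((\<lambda>t. (f (x + t) - f x) / t) \<longlongrightarrow> d) (at 0)"
      by (intro exI) (rule Lim_transform_eventually)
  qed
qed

section \<open>Rademacher's theorem\<close>

text \<open>The division-free form also covers \<open>t = 0\<close>, and its error terms can be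
  added.\<close>

lemma has_dir_deriv_alt:
  "has_dir_deriv f y v d \<longleftrightarrow>
    (\<forall>e>0. \<exists>\<delta>>0. \<forall>t. \<bar>t\<bar> < \<delta> \<longrightarrow> norm (f (y + t *\<^sub>R v) - f y - t *\<^sub>R d) \<le> e * \<bar>t\<bar>)"
proof -
  have quot: "norm (a /\<^sub>R t - d) = norm (a - t *\<^sub>R d) / \<bar>t\<bar>" if "t \<noteq> 0" for a and t :: real
  proof -
    have "a /\<^sub>R t - d = (a - t *\<^sub>R d) /\<^sub>R t"
      using that by (simp add: scaleR_diff_right)
    then show ?thesis by (simp add: divide_inverse mult.commute)
  qed
  show ?thesis
  proof (intro iffI allI impI)
    fix e :: real assume "has_dir_deriv f y v d" "e > 0"
    then obtain \<delta> where \<delta>: "\<delta> > 0"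
      "\<And>t. t \<noteq> 0 \<Longrightarrow> \<bar>t\<bar> < \<delta> \<Longrightarrow> norm ((f (y + t *\<^sub>R v) - f y) /\<^sub>R t - d) < e"
      unfolding has_dir_deriv_def tendsto_iff eventually_at by (auto simp: dist_norm)
    have "norm (f (y + t *\<^sub>R v) - f y - t *\<^sub>R d) \<le> e * \<bar>t\<bar>" if "\<bar>t\<bar> < \<delta>" for t
      using \<delta>(2)[OF _ that] by (cases "t = 0") (auto simp: quot divide_less_eq intro: less_imp_le)
    with \<delta> show "\<exists>\<delta>>0. \<forall>t. \<bar>t\<bar> < \<delta> \<longrightarrow> norm (f (y + t *\<^sub>R v) - f y - t *\<^sub>R d) \<le> e * \<bar>t\<bar>"
      by blast
  next
    assume *: "\<forall>e>0. \<exists>\<delta>>0. \<forall>t. \<bar>t\<bar> < \<delta> \<longrightarrow> norm (f (y + t *\<^sub>R v) - f y - t *\<^sub>R d) \<le> e * \<bar>t\<bar>"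
    show "has_dir_deriv f y v d"
      unfolding has_dir_deriv_def tendsto_iff eventually_at
    proof (intro allI impI)
      fix e :: real assume "e > 0"
      with * obtain \<delta> where \<delta>: "\<delta> > 0"
        "\<And>t. \<bar>t\<bar> < \<delta> \<Longrightarrow> norm (f (y + t *\<^sub>R v) - f y - t *\<^sub>R d) \<le> e / 2 * \<bar>t\<bar>"
        by (meson half_gt_zero)
      have "norm ((f (y + t *\<^sub>R v) - f y) /\<^sub>R t - d) < e" if "t \<noteq> 0" "\<bar>t\<bar> < \<delta>" for t
      proof -
        have "norm ((f (y + t *\<^sub>R v) - f y) /\<^sub>R t - d) \<le> e / 2"
          unfolding quot[OF that(1)] using \<delta>(2)[OF that(2)] that by (simp add: divide_le_eq)
        also have "\<dots> < e" using \<open>e > 0\<close> by simp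
        finally show ?thesis .
      qed
      then show "\<exists>\<delta>>0. \<forall>t\<in>UNIV. t \<noteq> 0 \<and> dist t 0 < \<delta> \<longrightarrow> dist ((f (y + t *\<^sub>R v) - f y) /\<^sub>R t) d < e"
        using \<delta>(1) by (auto simp: dist_norm)
    qed
  qed
qed

lemma has_dir_derivD:
  assumes "has_dir_deriv f y v d" "e > 0"
  obtains \<delta> where "\<delta> > 0" "\<And>t. \<bar>t\<bar> < \<delta> \<Longrightarrow> norm (f (y + t *\<^sub>R v) - f y - t *\<^sub>R d) \<le> e * \<bar>t\<bar>"
  using assms unfolding has_dir_deriv_alt by blast

lemma has_dir_deriv_scaleR:
  assumes "has_dir_deriv f x v d"
  shows "has_dir_deriv f x (c *\<^sub>R v) (c *\<^sub>R d)"
  unfolding has_dir_deriv_alt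
proof (intro allI impI)
  fix e :: real assume "e > 0"
  \<comment> \<open>The summand 1 keeps \<open>C\<close> positive when \<open>c = 0\<close>.\<close>
  define C where "C = \<bar>c\<bar> + 1"
  have C: "C > 0" "\<bar>c\<bar> \<le> C" by (auto simp: C_def)
  obtain \<delta> where \<delta>: "\<delta> > 0" "\<And>t. \<bar>t\<bar> < \<delta> \<Longrightarrow> norm (f (x + t *\<^sub>R v) - f x - t *\<^sub>R d) \<le> e / C * \<bar>t\<bar>"
    using has_dir_derivD[OF assms, of "e / C"] \<open>e > 0\<close> C by auto
  show "\<exists>\<delta>>0. \<forall>t. \<bar>t\<bar> < \<delta> \<longrightarrow> norm (f (x + t *\<^sub>R c *\<^sub>R v) - f x - t *\<^sub>R c *\<^sub>R d) \<le> e * \<bar>t\<bar>"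
  proof (intro exI[of _ "\<delta> / C"] conjI allI impI)
    fix t assume t: "\<bar>t\<bar> < \<delta> / C"
    have tc: "\<bar>t * c\<bar> \<le> \<bar>t\<bar> * C"
      using C by (simp add: abs_mult mult_left_mono)
    also have "\<dots> < \<delta>" using t C by (simp add: less_divide_eq)
    finally have "norm (f (x + (t * c) *\<^sub>R v) - f x - (t * c) *\<^sub>R d) \<le> e / C * \<bar>t * c\<bar>"
      by (rule \<delta>(2))
    also have "\<dots> \<le> e / C * (\<bar>t\<bar> * C)"
      using tc \<open>e > 0\<close> C by (intro mult_left_mono) auto
    finally show "norm (f (x + t *\<^sub>R c *\<^sub>R v) - f x - t *\<^sub>R c *\<^sub>R d) \<le> e * \<bar>t\<bar>"
      using C by simp
  qed (use \<delta> C in auto)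
qed

text \<open>The Cauchy criterion removes the unknown limit and leaves two countable quantifiers
  outside. For continuous \<open>f\<close> the inner condition is closed in \<open>x\<close>, being
  a universal statement with a non-strict inequality; this yields Borel measurability below.\<close>

lemma dir_differentiable_iff_Cauchy:
  fixes f :: "'a::real_normed_vector \<Rightarrow> 'b::banach"
  shows "dir_differentiable f x u \<longleftrightarrow>
    (\<forall>k::nat. \<exists>m::nat. \<forall>s t. 0 < \<bar>s\<bar> \<and> \<bar>s\<bar> < 1 / Suc m \<and> 0 < \<bar>t\<bar> \<and> \<bar>t\<bar> < 1 / Suc m \<longrightarrow>
      dist ((f (x + s *\<^sub>R u) - f x) /\<^sub>R s) ((f (x + t *\<^sub>R u) - f x) /\<^sub>R t) \<le> 1 / Suc k)"
    (is "_ \<longleftrightarrow> (\<forall>k. \<exists>m. ?P k m)")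
proof -
  let ?q = "\<lambda>t. (f (x + t *\<^sub>R u) - f x) /\<^sub>R t"
  have "dir_differentiable f x u \<longleftrightarrow> convergent_filter (filtermap ?q (at 0))"
    unfolding dir_differentiable_def has_dir_deriv_def convergent_filter_iff filterlim_def ..
  also have "\<dots> \<longleftrightarrow> (\<forall>e>0. \<exists>P. eventually P (at 0) \<and> (\<forall>s t. P s \<and> P t \<longrightarrow> dist (?q s) (?q t) < e))"
    by (simp only: convergent_filter_iff_cauchy cauchy_filter_metric_filtermap)
  also have "\<dots> \<longleftrightarrow> (\<forall>k. \<exists>m. ?P k m)"
  proof (intro iffI allI impI)
    fix k assume "\<forall>e>0. \<exists>P. eventually P (at 0) \<and> (\<forall>s t. P s \<and> P t \<longrightarrow> dist (?q s) (?q t) < e)"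
    then obtain P where P: "eventually P (at 0)" "\<And>s t. P s \<Longrightarrow> P t \<Longrightarrow> dist (?q s) (?q t) < 1 / Suc k"
      by (metis of_nat_0_less_iff zero_less_Suc zero_less_divide_1_iff)
    from P(1) obtain d where d: "d > 0" "\<And>t. 0 < \<bar>t\<bar> \<Longrightarrow> \<bar>t\<bar> < d \<Longrightarrow> P t"
      unfolding eventually_at by auto
    obtain m where "1 / Suc m < d" using nat_approx_posE[OF d(1)] by blast
    then have "?P k m" using d P(2) by (meson less_imp_le less_trans)
    then show "\<exists>m. ?P k m" ..
  next
    fix e :: real assume "\<forall>k. \<exists>m. ?P k m" "e > 0"
    then obtain k m where k: "1 / Suc k < e" and m: "?P k m"
      using nat_approx_posE by metis
    have "eventually (\<lambda>t. 0 < \<bar>t\<bar> \<and> \<bar>t\<bar> < 1 / Suc m) (at (0::real))"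
      unfolding eventually_at by (intro exI[of _ "1 / Suc m"]) auto
    moreover have "dist (?q s) (?q t) < e"
      if "(0 < \<bar>s\<bar> \<and> \<bar>s\<bar> < 1 / Suc m) \<and> 0 < \<bar>t\<bar> \<and> \<bar>t\<bar> < 1 / Suc m" for s t
    proof -
      have "dist (?q s) (?q t) \<le> 1 / Suc k" using m that by blast
      with k show ?thesis by (rule le_less_trans[rotated])
    qed
    ultimately show "\<exists>P. eventually P (at 0) \<and> (\<forall>s t. P s \<and> P t \<longrightarrow> dist (?q s) (?q t) < e)"
      by (intro exI[of _ "\<lambda>t. 0 < \<bar>t\<bar> \<and> \<bar>t\<bar> < 1 / Suc m"] conjI allI impI)
  qed
  finally show ?thesis .
qed

lemma borel_dir_differentiable:
  fixes f :: "'a::euclidean_space \<Rightarrow> 'b::banach"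
  assumes f: "continuous_on UNIV f"
  shows "{x. dir_differentiable f x u} \<in> sets borel"
proof -
  have [continuous_intros]: "continuous_on UNIV (\<lambda>x. f (x + v))" for v
    by (rule continuous_on_compose2[OF f]) (auto intro: continuous_intros)
  define E where "E k m = {x. \<forall>s t. 0 < \<bar>s\<bar> \<and> \<bar>s\<bar> < 1 / Suc m \<and> 0 < \<bar>t\<bar> \<and> \<bar>t\<bar> < 1 / Suc m \<longrightarrow>
      dist ((f (x + s *\<^sub>R u) - f x) /\<^sub>R s) ((f (x + t *\<^sub>R u) - f x) /\<^sub>R t) \<le> 1 / Suc k}" for m k :: nat
  have "closed (E k m)" for k m
    unfolding E_def
    by (intro closed_Collect_all closed_Collect_imp open_Collect_const closed_Collect_le continuous_intros f)
  then have "E k m \<in> sets borel" for k m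
    by (rule borel_closed)
  then have "(\<Inter>k. \<Union>m. E k m) \<in> sets borel"
    by (intro sets.countable_INT) (auto intro!: sets.countable_UN)
  moreover have "{x. dir_differentiable f x u} = (\<Inter>k. \<Union>m. E k m)"
    unfolding dir_differentiable_iff_Cauchy E_def by auto
  ultimately show ?thesis by simp
qed

section \<open>Existence almost everywhere in a fixed direction\<close>

text \<open>All translates of \<open>N\<close> have the same measure, so the measure of \<open>N\<close> is the average over
  \<open>0 \<le> t \<le> 1\<close> of the measures of \<open>N - t u\<close>; Tonelli turns it into an integral over lines.\<close>
lemma null_set_of_null_lines:
  fixes N :: "'a::euclidean_space set"
  assumes [measurable]: "N \<in> sets borel"
    and lines: "\<And>x. AE t in lborel. x + t *\<^sub>R u \<notin> N"
  shows "N \<in> null_sets lborel"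
proof -
  have "emeasure lborel N = (\<integral>\<^sup>+t. indicator {0..1::real} t * emeasure lborel N \<partial>lborel)"
    by (simp add: nn_integral_multc)
  also have "\<dots> = (\<integral>\<^sup>+t. (\<integral>\<^sup>+x. indicator {0..1::real} t * indicator N (x + t *\<^sub>R u) \<partial>lborel) \<partial>lborel)"
  proof (intro nn_integral_cong)
    fix t :: real
    have "emeasure lborel N = (\<integral>\<^sup>+x. indicator N x \<partial>distr lborel borel ((+) (t *\<^sub>R u)))"
      by (simp add: lborel_distr_plus)
    also have "\<dots> = (\<integral>\<^sup>+x. indicator N (x + t *\<^sub>R u) \<partial>lborel)"
      by (subst nn_integral_distr) (auto simp: add.commute)
    finally show "indicator {0..1::real} t * emeasure lborel N =
        (\<integral>\<^sup>+x. indicator {0..1::real} t * indicator N (x + t *\<^sub>R u) \<partial>lborel)"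
      by (simp add: nn_integral_cmult)
  qed
  also have "\<dots> = (\<integral>\<^sup>+x. (\<integral>\<^sup>+t. indicator {0..1::real} t * indicator N (x + t *\<^sub>R u) \<partial>lborel) \<partial>lborel)"
    by (rule lborel_pair.Fubini') measurable
  also have "\<dots> = (\<integral>\<^sup>+x. 0 \<partial>(lborel :: 'a measure))"
  proof (intro nn_integral_cong)
    fix x :: 'a
    have "(\<integral>\<^sup>+t. indicator {0..1::real} t * indicator N (x + t *\<^sub>R u) \<partial>lborel) = (\<integral>\<^sup>+t. 0 \<partial>(lborel :: real measure))"
      by (rule nn_integral_cong_AE) (use lines[of x] in auto)
    then show "(\<integral>\<^sup>+t. indicator {0..1::real} t * indicator N (x + t *\<^sub>R u) \<partial>lborel) = 0" by simp
  qed
  finally show ?thesis by (auto simp: null_sets_def)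
qed

text \<open>On each line parallel to \<open>u\<close> the function is Lipschitz with constant
  \<open>L * norm u\<close>, so the Borel set of bad points meets the line in a null set of
  parameters.\<close>

lemma lipschitz_AE_dir_differentiable:
  fixes f :: "'a::euclidean_space \<Rightarrow> real"
  assumes f: "L-lipschitz_on UNIV f"
  shows "AE x in lborel. dir_differentiable f x u"
proof -
  have "- {x. dir_differentiable f x u} \<in> sets borel"
    using borel_dir_differentiable[OF lipschitz_on_continuous_on[OF f]] by auto
  moreover have "AE t in lborel. x + t *\<^sub>R u \<notin> - {x. dir_differentiable f x u}" for x
  proof -
    have "(L * norm u)-lipschitz_on UNIV (\<lambda>t. f (x + t *\<^sub>R u))"
    proof (rule lipschitz_onI)
      fix s t
      have "dist (f (x + s *\<^sub>R u)) (f (x + t *\<^sub>R u)) \<le> L * dist (x + s *\<^sub>R u) (x + t *\<^sub>R u)"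
        by (rule lipschitz_onD[OF f]) auto
      also have "dist (x + s *\<^sub>R u) (x + t *\<^sub>R u) = norm u * dist s t"
        by (simp add: dist_norm scaleR_diff_left[symmetric])
      finally show "dist (f (x + s *\<^sub>R u)) (f (x + t *\<^sub>R u)) \<le> L * norm u * dist s t"
        by simp
    qed (use lipschitz_on_nonneg[OF f] in auto)
    from lipschitz_AE_derivative[OF this] show ?thesis
    proof (rule AE_mp, intro AE_I2 impI)
      fix t assume "\<exists>d. ((\<lambda>s. (f (x + (t + s) *\<^sub>R u) - f (x + t *\<^sub>R u)) / s) \<longlongrightarrow> d) (at 0)"
      then have "dir_differentiable f (x + t *\<^sub>R u) u"
        by (simp add: dir_differentiable_def has_dir_deriv_def divide_inverse mult.commute scaleR_add_left add.assoc)
      then show "x + t *\<^sub>R u \<notin> - {x. dir_differentiable f x u}" by simp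
    qed
  qed
  ultimately have "- {x. dir_differentiable f x u} \<in> null_sets lborel"
    by (rule null_set_of_null_lines)
  then show ?thesis
    by (rule AE_I') auto
qed

section \<open>Additivity in the direction\<close>

lemma infdist_less_obtain:
  assumes "infdist x A < e" "A \<noteq> {}"
  obtains a where "a \<in> A" "dist x a < e"
  using assms by (auto simp: infdist_notempty cInf_less_iff image_iff)

lemma lipschitz_on_infdist: "1-lipschitz_on UNIV (\<lambda>x. infdist x A)"
  by (rule lipschitz_onI) (auto simp: dist_real_def infdist_triangle_abs)

text \<open>The distance to \<open>A\<close> has a minimum at every point of \<open>A\<close>, so a
  two-sided derivative can only be 0 there.\<close>

lemma infdist_small_of_dir_differentiable:
  assumes "dir_differentiable (\<lambda>y. infdist y A) x u" "x \<in> A" "e > 0"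
  obtains \<delta> where "\<delta> > 0" "\<And>t. \<bar>t\<bar> < \<delta> \<Longrightarrow> infdist (x + t *\<^sub>R u) A \<le> e * \<bar>t\<bar>"
proof -
  from assms(1) obtain d where "has_dir_deriv (\<lambda>y. infdist y A) x u d"
    by (auto simp: dir_differentiable_def)
  then obtain \<delta> where \<delta>: "\<delta> > 0"
    "\<And>t. \<bar>t\<bar> < \<delta> \<Longrightarrow> norm (infdist (x + t *\<^sub>R u) A - infdist x A - t *\<^sub>R d) \<le> e / 2 * \<bar>t\<bar>"
    using has_dir_derivD[of "\<lambda>y. infdist y A" x u d "e/2"] assms(3) by auto
  have "infdist (x + t *\<^sub>R u) A \<le> e * \<bar>t\<bar>" if "\<bar>t\<bar> < \<delta>" for t
  proof -
    \<comment> \<open>The estimate at \<open>- t\<close> and nonnegativity of the distance give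
      \<open>t * d \<le> e / 2 * \<bar>t\<bar>\<close>, which is then used in the estimate at
      \<open>t\<close>.\<close>
    have "infdist (x + t *\<^sub>R u) A - t * d \<le> e / 2 * \<bar>t\<bar>"
      using abs_le_D1[OF \<delta>(2)[of t, unfolded real_norm_def]] that assms(2) by simp
    moreover have "infdist (x + (- t) *\<^sub>R u) A + t * d \<le> e / 2 * \<bar>t\<bar>"
      using abs_le_D1[OF \<delta>(2)[of "- t", unfolded real_norm_def]] that assms(2) by simp
    ultimately show ?thesis
      using infdist_nonneg[of "x + (- t) *\<^sub>R u" A] by linarith
  qed
  with \<delta>(1) show ?thesis by (rule that)
qed

text \<open>Splitting the increment along \<open>u + v\<close> at \<open>x + t *\<^sub>R u\<close>
  leaves an increment along \<open>v\<close> from a moving base point. That point is replaced by a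
  nearby \<open>y\<close> at which the quotients along \<open>v\<close> are almost those at
  \<open>x\<close>; the Lipschitz bound pays for the replacement.\<close>

lemma lipschitz_AE_dir_deriv_add:
  fixes f :: "'a::euclidean_space \<Rightarrow> real"
  assumes f: "L-lipschitz_on UNIV f"
  shows "AE x in lborel. \<forall>a b. has_dir_deriv f x u a \<longrightarrow> has_dir_deriv f x v b \<longrightarrow> has_dir_deriv f x (u + v) (a + b)"
proof -
  \<comment> \<open>Scale and tolerance are the same for all points of \<open>A (z, k, m)\<close>,
    so an estimate known at \<open>x\<close> is available at nearby points of the set. Rational
    \<open>z\<close> leave only countably many sets.\<close>
  define A where "A = (\<lambda>(z, k, m). {y. \<forall>t. \<bar>t\<bar> < 1 / Suc m \<longrightarrow> \<bar>f (y + t *\<^sub>R v) - f y - t * z\<bar> \<le> \<bar>t\<bar> / Suc k})"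
  have L: "L \<ge> 0" using lipschitz_on_nonneg[OF f] .
  have "AE x in lborel. \<forall>i\<in>\<rat> \<times> (UNIV :: nat set) \<times> (UNIV :: nat set). dir_differentiable (\<lambda>y. infdist y (A i)) x u"
    by (intro AE_ball_countable' lipschitz_AE_dir_differentiable[OF lipschitz_on_infdist] countable_SIGMA)
       (auto simp: countable_rat)
  then show ?thesis
  proof (rule AE_mp, intro AE_I2 impI allI)
    fix x a b
    assume good: "\<forall>i\<in>\<rat> \<times> (UNIV :: nat set) \<times> (UNIV :: nat set). dir_differentiable (\<lambda>y. infdist y (A i)) x u"
      and a: "has_dir_deriv f x u a" and b: "has_dir_deriv f x v b"
    show "has_dir_deriv f x (u + v) (a + b)"
      unfolding has_dir_deriv_alt
    proof (intro allI impI)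
      fix e :: real assume "e > 0"
      \<comment> \<open>The final estimate has two Lipschitz errors of size
        \<open>L * \<eta> * \<bar>t\<bar>\<close> and three more of at most
        \<open>\<eta> * \<bar>t\<bar>\<close> each.\<close>
      then obtain k where k: "1 / Suc k < e / (3 + 2 * L)"
        using nat_approx_posE[of "e / (3 + 2 * L)"] L by (auto simp: add_pos_nonneg)
      define \<eta> where "\<eta> = 1 / Suc k"
      have \<eta>: "\<eta> > 0" "(3 + 2 * L) * \<eta> \<le> e"
        using k L by (auto simp: \<eta>_def field_simps add_pos_nonneg)
      obtain \<delta>1 where \<delta>1: "\<delta>1 > 0" "\<And>t. \<bar>t\<bar> < \<delta>1 \<Longrightarrow> \<bar>f (x + t *\<^sub>R u) - f x - t * a\<bar> \<le> \<eta> * \<bar>t\<bar>"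
        using has_dir_derivD[OF a \<eta>(1)] by auto
      obtain \<delta>2 where \<delta>2: "\<delta>2 > 0" "\<And>t. \<bar>t\<bar> < \<delta>2 \<Longrightarrow> \<bar>f (x + t *\<^sub>R v) - f x - t * b\<bar> \<le> \<eta> / 2 * \<bar>t\<bar>"
        using has_dir_derivD[OF b, of "\<eta> / 2"] \<eta>(1) by auto
      \<comment> \<open>Half of \<open>\<eta>\<close> goes into replacing \<open>b\<close> by a
        rational \<open>z\<close>, the other half into the quotients at \<open>x\<close>, so that
        \<open>x\<close> lies in \<open>A (z, k, m)\<close>.\<close>
      obtain z where z: "z \<in> \<rat>" "b < z" "z < b + \<eta> / 2"
        using Rats_dense_in_real[of b "b + \<eta> / 2"] \<eta>(1) by auto
      obtain m where m: "1 / Suc m < \<delta>2" using nat_approx_posE[OF \<delta>2(1)] by blast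
      have zb: "\<bar>t * z - t * b\<bar> \<le> \<eta> / 2 * \<bar>t\<bar>" for t
      proof -
        have "\<bar>t * z - t * b\<bar> = (z - b) * \<bar>t\<bar>"
          using z by (simp add: abs_mult right_diff_distrib[symmetric])
        also have "\<dots> \<le> \<eta> / 2 * \<bar>t\<bar>" using z by (intro mult_right_mono) auto
        finally show ?thesis .
      qed
      have "x \<in> A (z, k, m)"
        unfolding A_def
      proof (clarsimp)
        fix t :: real assume "\<bar>t\<bar> < 1 / (1 + real m)"
        then have "\<bar>t\<bar> < \<delta>2" using m by simp
        then have "\<bar>f (x + t *\<^sub>R v) - f x - t * z\<bar> \<le> \<eta> * \<bar>t\<bar>"
          using \<delta>2(2)[of t] zb[of t] by linarith
        then show "\<bar>f (x + t *\<^sub>R v) - f x - t * z\<bar> \<le> \<bar>t\<bar> / (1 + real k)"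
          by (simp add: \<eta>_def)
      qed
      moreover have "dir_differentiable (\<lambda>y. infdist y (A (z, k, m))) x u"
        using good z by blast
      ultimately obtain \<delta>3 where \<delta>3: "\<delta>3 > 0" "\<And>t. \<bar>t\<bar> < \<delta>3 \<Longrightarrow> infdist (x + t *\<^sub>R u) (A (z, k, m)) \<le> \<eta> / 2 * \<bar>t\<bar>"
        using infdist_small_of_dir_differentiable[of "A (z, k, m)" x u "\<eta> / 2"] \<eta>(1) by auto
      have "\<bar>f (x + t *\<^sub>R (u + v)) - f x - t * (a + b)\<bar> \<le> e * \<bar>t\<bar>"
        if t: "\<bar>t\<bar> < Min {\<delta>1, \<delta>3, 1 / Suc m}" for t
      proof (cases "t = 0")
        case False
        have "infdist (x + t *\<^sub>R u) (A (z, k, m)) \<le> \<eta> / 2 * \<bar>t\<bar>"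
          using t by (intro \<delta>3) auto
        \<comment> \<open>The infimum need not be attained at a point of the set; the strict
          inequality, valid for \<open>t \<noteq> 0\<close>, provides \<open>y\<close>.\<close>
        also have "\<dots> < \<eta> * \<bar>t\<bar>" using \<eta> False by simp
        finally obtain y where y: "y \<in> A (z, k, m)" "dist (x + t *\<^sub>R u) y < \<eta> * \<bar>t\<bar>"
          using infdist_less_obtain \<open>x \<in> A (z, k, m)\<close> by blast
        have "\<bar>f (x + t *\<^sub>R (u + v)) - f (y + t *\<^sub>R v)\<bar> \<le> L * dist (x + t *\<^sub>R (u + v)) (y + t *\<^sub>R v)"
          using lipschitz_onD[OF f, of "x + t *\<^sub>R (u + v)" "y + t *\<^sub>R v"] by (simp add: dist_real_def)
        also have "dist (x + t *\<^sub>R (u + v)) (y + t *\<^sub>R v) = dist (x + t *\<^sub>R u) y"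
          by (simp add: dist_norm scaleR_add_right)
        finally have 1: "\<bar>f (x + t *\<^sub>R (u + v)) - f (y + t *\<^sub>R v)\<bar> \<le> L * dist (x + t *\<^sub>R u) y" .
        have 2: "\<bar>f (x + t *\<^sub>R u) - f y\<bar> \<le> L * dist (x + t *\<^sub>R u) y"
          using lipschitz_onD[OF f, of "x + t *\<^sub>R u" y] by (simp add: dist_real_def)
        have 3: "L * dist (x + t *\<^sub>R u) y \<le> L * (\<eta> * \<bar>t\<bar>)"
          using y L by (intro mult_left_mono) auto
        have 4: "\<bar>f (y + t *\<^sub>R v) - f y - t * z\<bar> \<le> \<eta> * \<bar>t\<bar>"
          using y(1) t by (simp add: A_def \<eta>_def)
        have 5: "\<bar>f (x + t *\<^sub>R u) - f x - t * a\<bar> \<le> \<eta> * \<bar>t\<bar>"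
          using t by (intro \<delta>1) auto
        \<comment> \<open>The increment is routed through \<open>y + t *\<^sub>R v\<close>,
          \<open>y\<close> and \<open>x + t *\<^sub>R u\<close>; the last term exchanges
          \<open>z\<close> for \<open>b\<close>.\<close>
        have eq: "f (x + t *\<^sub>R (u + v)) - f x - t * (a + b) = (f (x + t *\<^sub>R (u + v)) - f (y + t *\<^sub>R v))
            + (f y - f (x + t *\<^sub>R u)) + (f (y + t *\<^sub>R v) - f y - t * z) + (f (x + t *\<^sub>R u) - f x - t * a) + (t * z - t * b)"
          by (simp add: distrib_left)
        have sum5: "\<bar>p + q + r + s + w\<bar> \<le> P + Q + R + S + W"
          if "\<bar>p\<bar> \<le> P" "\<bar>q\<bar> \<le> Q" "\<bar>r\<bar> \<le> R" "\<bar>s\<bar> \<le> S" "\<bar>w\<bar> \<le> W" for p q r s w P Q R S W :: real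
          using that by (simp add: abs_le_iff)
        have "\<bar>f (x + t *\<^sub>R (u + v)) - f x - t * (a + b)\<bar>
            \<le> L * (\<eta> * \<bar>t\<bar>) + L * (\<eta> * \<bar>t\<bar>) + \<eta> * \<bar>t\<bar> + \<eta> * \<bar>t\<bar> + \<eta> / 2 * \<bar>t\<bar>"
          unfolding eq
          by (rule sum5[OF order_trans[OF 1 3] order_trans[OF 2[unfolded abs_minus_commute[of "f (x + t *\<^sub>R u)"]] 3] 4 5 zb])
        also have "\<dots> \<le> (3 + 2 * L) * \<eta> * \<bar>t\<bar>"
          using \<eta>(1) by (simp add: algebra_simps)
        also have "\<dots> \<le> e * \<bar>t\<bar>"
          using \<eta>(2) by (intro mult_right_mono) auto
        finally show ?thesis .
      qed simp
      then show "\<exists>\<delta>>0. \<forall>t. \<bar>t\<bar> < \<delta> \<longrightarrow> norm (f (x + t *\<^sub>R (u + v)) - f x - t *\<^sub>R (a + b)) \<le> e * \<bar>t\<bar>"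
        using \<delta>1 \<delta>3 by (intro exI[of _ "Min {\<delta>1, \<delta>3, 1 / Suc m}"]) auto
    qed
  qed
qed

section \<open>Linearity in the direction and full differentiability\<close>

lemma dir_deriv_eq: "has_dir_deriv f x v d \<Longrightarrow> dir_deriv f x v = d"
  unfolding has_dir_deriv_def dir_deriv_def by (rule tendsto_Lim[OF at_neq_bot])

text \<open>Coordinate directions are added one at a time, by homogeneity and additivity. The
  exceptional null set depends on \<open>u\<close>.\<close>

lemma lipschitz_AE_dir_deriv_linear:
  fixes f :: "'a::euclidean_space \<Rightarrow> real"
  assumes f: "L-lipschitz_on UNIV f"
  shows "AE x in lborel. has_dir_deriv f x u (\<Sum>b\<in>Basis. (u \<bullet> b) *\<^sub>R dir_deriv f x b)"
proof -
  have "AE x in lborel. has_dir_deriv f x (\<Sum>b\<in>B. (u \<bullet> b) *\<^sub>R b) (\<Sum>b\<in>B. (u \<bullet> b) *\<^sub>R dir_deriv f x b)"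
    if "finite B" for B
    using that
  proof (induction B rule: finite_induct)
    case empty
    show ?case by (auto simp: has_dir_deriv_def)
  next
    case (insert b B)
    show ?case
      using insert.IH lipschitz_AE_dir_differentiable[OF f, of b]
        lipschitz_AE_dir_deriv_add[OF f, of "(u \<bullet> b) *\<^sub>R b" "\<Sum>b\<in>B. (u \<bullet> b) *\<^sub>R b"]
    proof eventually_elim
      case (elim x)
      from elim(2) have "has_dir_deriv f x b (dir_deriv f x b)"
        unfolding dir_differentiable_def using dir_deriv_eq by metis
      then have "has_dir_deriv f x ((u \<bullet> b) *\<^sub>R b) ((u \<bullet> b) *\<^sub>R dir_deriv f x b)"
        by (rule has_dir_deriv_scaleR)
      with elim(1,3) insert.hyps show ?case by simp
    qed
  qed
  from this[OF finite_Basis] show ?thesis by (simp add: euclidean_representation)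
qed

text \<open>By compactness of the unit sphere, finitely many directions in \<open>D\<close> are
  \<open>\<eta>\<close>-dense on it, and for these the estimates hold at a common scale. The
  Lipschitz bound on \<open>f\<close> and the bound on \<open>T\<close> carry them over to all
  directions.\<close>

lemma has_derivative_of_dense_dir_derivs:
  fixes f :: "'a::euclidean_space \<Rightarrow> 'b::real_normed_vector"
  assumes f: "L-lipschitz_on UNIV f" and T: "bounded_linear T"
    and dense: "\<And>S. open S \<Longrightarrow> S \<noteq> {} \<Longrightarrow> \<exists>u\<in>D. u \<in> S"
    and dir: "\<And>u. u \<in> D \<Longrightarrow> has_dir_deriv f x u (T u)"
  shows "(f has_derivative T) (at x)"
  unfolding has_derivative_at_alt
proof (intro conjI allI impI T)
  interpret T: bounded_linear T by fact
  fix e :: real assume "e > 0"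
  have L: "L \<ge> 0" using lipschitz_on_nonneg[OF f] .
  obtain K where K: "K > 0" "\<And>v. norm (T v) \<le> norm v * K" using T.pos_bounded by blast
  \<comment> \<open>The three summands \<open>1\<close>, \<open>L\<close> and \<open>K\<close> are
    the costs of the estimate along \<open>u\<close>, of moving \<open>f\<close> from direction
    \<open>w\<close> to \<open>u\<close>, and of moving \<open>T\<close>.\<close>
  define \<eta> where "\<eta> = e / (1 + L + K)"
  have pos: "1 + L + K > 0" using L K by simp
  have \<eta>: "\<eta> > 0" "\<eta> + L * \<eta> + K * \<eta> = e"
  proof -
    have "\<eta> * (1 + L + K) = e" using pos by (simp add: \<eta>_def)
    then show "\<eta> + L * \<eta> + K * \<eta> = e" by (simp add: algebra_simps)
    show "\<eta> > 0" using pos \<open>e > 0\<close> by (simp add: \<eta>_def)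
  qed
  have cover: "sphere 0 1 \<subseteq> (\<Union>u\<in>D. ball u \<eta>)"
  proof
    fix w :: 'a
    have "ball w \<eta> \<noteq> {}" using \<eta> by simp
    then obtain u where "u \<in> D" "u \<in> ball w \<eta>" using dense[OF open_ball] by blast
    then show "w \<in> (\<Union>u\<in>D. ball u \<eta>)" by (auto simp: dist_commute)
  qed
  obtain D' where D': "D' \<subseteq> D" "finite D'" "sphere 0 1 \<subseteq> (\<Union>u\<in>D'. ball u \<eta>)"
    by (rule compactE_image[OF compact_sphere _ cover]) auto
  have "\<exists>\<delta>>0. \<forall>t. \<bar>t\<bar> < \<delta> \<longrightarrow> norm (f (x + t *\<^sub>R u) - f x - t *\<^sub>R T u) \<le> \<eta> * \<bar>t\<bar>" if "u \<in> D'" for u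
    using dir[of u] D'(1) that \<eta>(1) unfolding has_dir_deriv_alt by blast
  then obtain \<delta> where \<delta>: "\<And>u. u \<in> D' \<Longrightarrow> \<delta> u > 0"
    "\<And>u t. u \<in> D' \<Longrightarrow> \<bar>t\<bar> < \<delta> u \<Longrightarrow> norm (f (x + t *\<^sub>R u) - f x - t *\<^sub>R T u) \<le> \<eta> * \<bar>t\<bar>"
    by metis
  \<comment> \<open>\<open>insert 1\<close> ensures that the minimum is over a nonempty set.\<close>
  define d where "d = Min (insert 1 (\<delta> ` D'))"
  have d: "d > 0" "\<And>u. u \<in> D' \<Longrightarrow> d \<le> \<delta> u"
    using D'(2) \<delta>(1) by (auto simp: d_def)
  have "norm (f y - f x - T (y - x)) \<le> e * norm (y - x)" if y: "norm (y - x) < d" for y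
  proof (cases "y = x")
    case False
    define t w where "t = norm (y - x)" and "w = (y - x) /\<^sub>R t"
    have t: "t > 0" and yx: "y = x + t *\<^sub>R w" and w: "norm w = 1"
      using False by (auto simp: t_def w_def)
    then obtain u where u: "u \<in> D'" "norm (w - u) \<le> \<eta>"
      using D'(3) by (force simp: dist_norm norm_minus_commute)
    have "f y - f x - T (y - x) = (f y - f (x + t *\<^sub>R u)) + (f (x + t *\<^sub>R u) - f x - t *\<^sub>R T u) - t *\<^sub>R T (w - u)"
      by (simp add: yx T.scaleR T.diff scaleR_diff_right)
    also have "norm \<dots> \<le> norm (f y - f (x + t *\<^sub>R u)) + norm (f (x + t *\<^sub>R u) - f x - t *\<^sub>R T u) + norm (t *\<^sub>R T (w - u))"
      by (meson add_right_mono norm_triangle_ineq norm_triangle_ineq4 order_trans)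
    also have "\<dots> \<le> L * \<eta> * t + \<eta> * t + K * \<eta> * t"
    proof (intro add_mono)
      have "norm (f y - f (x + t *\<^sub>R u)) \<le> L * dist y (x + t *\<^sub>R u)"
        using lipschitz_onD[OF f, of y "x + t *\<^sub>R u"] by (simp add: dist_norm)
      also have "dist y (x + t *\<^sub>R u) = t * norm (w - u)"
        using t by (simp add: yx dist_norm scaleR_diff_right[symmetric])
      also have "L * \<dots> \<le> L * (t * \<eta>)"
        using u L t by (intro mult_left_mono) auto
      finally show "norm (f y - f (x + t *\<^sub>R u)) \<le> L * \<eta> * t" by (simp add: ac_simps)
      show "norm (f (x + t *\<^sub>R u) - f x - t *\<^sub>R T u) \<le> \<eta> * t"
        using \<delta>(2)[OF u(1), of t] d(2)[OF u(1)] t y by (simp add: t_def)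
      have "norm (t *\<^sub>R T (w - u)) \<le> t * (norm (w - u) * K)"
        using K(2)[of "w - u"] t by simp
      also have "\<dots> \<le> t * (\<eta> * K)"
        using u K t by (intro mult_left_mono mult_right_mono) auto
      finally show "norm (t *\<^sub>R T (w - u)) \<le> K * \<eta> * t" by (simp add: ac_simps)
    qed
    also have "\<dots> = e * t" unfolding \<eta>(2)[symmetric] by (simp add: algebra_simps)
    finally show ?thesis by (simp add: t_def)
  qed (simp add: T.zero)
  with d(1) show "\<exists>d>0. \<forall>y. norm (y - x) < d \<longrightarrow> norm (f y - f x - T (y - x)) \<le> e * norm (y - x)"
    by blast
qed

text \<open>A countable dense set of directions keeps the exceptional set null, and the remaining
  directions follow by density.\<close>

theorem Rademacher:
  fixes f :: "'a::euclidean_space \<Rightarrow> real"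
  assumes f: "L-lipschitz_on UNIV f"
  shows "AE x in lborel. f differentiable (at x)"
proof -
  obtain D :: "'a set" where D: "countable D" "\<And>S. open S \<Longrightarrow> S \<noteq> {} \<Longrightarrow> \<exists>u\<in>D. u \<in> S"
    using countable_dense_setE by blast
  have "AE x in lborel. \<forall>u\<in>D. has_dir_deriv f x u (\<Sum>b\<in>Basis. (u \<bullet> b) *\<^sub>R dir_deriv f x b)"
    by (intro AE_ball_countable' lipschitz_AE_dir_deriv_linear[OF f] D)
  then show ?thesis
  proof eventually_elim
    case (elim x)
    have "(f has_derivative (\<lambda>u. \<Sum>b\<in>Basis. (u \<bullet> b) *\<^sub>R dir_deriv f x b)) (at x)"
    proof (rule has_derivative_of_dense_dir_derivs[OF f _ D(2)])
      show "bounded_linear (\<lambda>u. \<Sum>b\<in>Basis. (u \<bullet> b) *\<^sub>R dir_deriv f x b)"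
        by (intro bounded_linear_sum bounded_linear_scaleR_left bounded_linear_compose[OF bounded_linear_scaleR_left] bounded_linear_inner_left)
    qed (use elim in auto)
    then show ?case by (rule differentiableI)
  qed
qed

section \<open>Stepanov's theorem and the chain rule\<close>

definition lipschitz_at :: "('a::metric_space \<Rightarrow> 'b::metric_space) \<Rightarrow> 'a \<Rightarrow> bool"
  where "lipschitz_at f x \<longleftrightarrow> (\<exists>L. \<forall>\<^sub>F z in nhds x. dist (f z) (f x) \<le> L * dist z x)"

text \<open>McShane's formula: for \<open>g\<close> bounded below on a nonempty \<open>B\<close> and
  \<open>L \<ge> 0\<close>, the largest \<open>L\<close>-Lipschitz function on the whole space that
  lies below \<open>g\<close> on \<open>B\<close>.\<close>

definition lower_envelope :: "'a::metric_space set \<Rightarrow> real \<Rightarrow> ('a \<Rightarrow> real) \<Rightarrow> 'a \<Rightarrow> real"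
  where "lower_envelope B L g x = (INF z\<in>B. g z + L * dist x z)"

lemma bdd_below_lower_envelope:
  assumes "bdd_below (g ` B)" "L \<ge> 0"
  shows "bdd_below ((\<lambda>z. g z + L * dist x z) ` B)"
proof -
  obtain m where m: "\<And>z. z \<in> B \<Longrightarrow> m \<le> g z" using assms(1) by (auto simp: bdd_below_def)
  show ?thesis
  proof (rule bdd_belowI2[where m=m])
    fix z assume "z \<in> B"
    then show "m \<le> g z + L * dist x z" using m[of z] assms(2) by (simp add: add_increasing2)
  qed
qed

lemma lipschitz_lower_envelope:
  assumes "B \<noteq> {}" "bdd_below (g ` B)" "L \<ge> 0"
  shows "L-lipschitz_on UNIV (lower_envelope B L g)"
proof -
  have *: "lower_envelope B L g x - L * dist x y \<le> lower_envelope B L g y" for x y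
    unfolding lower_envelope_def[of B L g y]
  proof (rule cINF_greatest[OF assms(1)])
    fix z assume z: "z \<in> B"
    have "lower_envelope B L g x \<le> g z + L * dist x z"
      unfolding lower_envelope_def by (rule cINF_lower[OF bdd_below_lower_envelope[OF assms(2,3)] z])
    also have "\<dots> \<le> g z + L * (dist x y + dist y z)"
      using assms(3) by (intro add_left_mono mult_left_mono dist_triangle)
    finally show "lower_envelope B L g x - L * dist x y \<le> g z + L * dist y z"
      by (simp add: algebra_simps)
  qed
  show ?thesis
  proof (rule lipschitz_onI)
    fix x y
    show "dist (lower_envelope B L g x) (lower_envelope B L g y) \<le> L * dist x y"
      using *[of x y] *[of y x] by (simp add: dist_real_def abs_le_iff dist_commute algebra_simps)
  qed fact
qed

lemma lower_envelope_le:
  assumes "x \<in> B" "bdd_below (g ` B)" "L \<ge> 0"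
  shows "lower_envelope B L g x \<le> g x"
  unfolding lower_envelope_def
  using cINF_lower[OF bdd_below_lower_envelope[OF assms(2,3)] assms(1), of x] by simp

lemma lower_envelope_eq:
  assumes "x \<in> B" "bdd_below (g ` B)" "L \<ge> 0"
    and "\<And>z. z \<in> B \<Longrightarrow> g x - L * dist z x \<le> g z"
  shows "lower_envelope B L g x = g x"
proof (rule antisym[OF lower_envelope_le[OF assms(1-3)]])
  show "g x \<le> lower_envelope B L g x"
    unfolding lower_envelope_def
  proof (rule cINF_greatest)
    fix z assume "z \<in> B"
    from assms(4)[OF this] show "g x \<le> g z + L * dist x z" by (simp add: dist_commute)
  qed (use assms(1) in auto)
qed

text \<open>Countability comes from taking \<open>B\<close> in a countable basis and the Lipschitz
  constant among the naturals. A basic neighbourhood of \<open>x\<close> on which the estimate at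
  \<open>x\<close> holds, with the constant rounded up, gives envelopes touching \<open>g\<close> at
  \<open>x\<close>.\<close>

lemma countable_lipschitz_envelopes:
  fixes g :: "'a::{metric_space,second_countable_topology} \<Rightarrow> real"
  obtains I where "countable I"
    "\<And>l u. (l, u) \<in> I \<Longrightarrow> (\<exists>L. L-lipschitz_on UNIV l) \<and> (\<exists>L. L-lipschitz_on UNIV u)"
    "\<And>x. lipschitz_at g x \<Longrightarrow> \<exists>(l, u)\<in>I. l x = g x \<and> u x = g x \<and> (\<forall>\<^sub>F z in nhds x. l z \<le> g z \<and> g z \<le> u z)"
proof -
  obtain \<B> :: "'a set set" where \<B>: "countable \<B>" "topological_basis \<B>"
    using ex_countable_basis by blast
  \<comment> \<open>These conditions make the infima genuine; both bounds occur because the upper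
    envelope is minus the lower envelope of \<open>- g\<close>.\<close>
  let ?good = "\<lambda>B. B \<noteq> {} \<and> bdd_below (g ` B) \<and> bdd_below ((\<lambda>z. - g z) ` B)"
  let ?env = "\<lambda>(B, n::nat). (lower_envelope B (real n) g, \<lambda>x. - lower_envelope B (real n) (\<lambda>z. - g z) x)"
  define I where "I = ?env ` ((\<B> \<inter> Collect ?good) \<times> UNIV)"
  show thesis
  proof (rule that[of I])
    show "countable I" unfolding I_def using \<B>(1) by (intro countable_image countable_SIGMA countable_Int1) auto
  next
    fix l u assume "(l, u) \<in> I"
    then obtain B n where "?good B" and lu: "l = lower_envelope B (real n) g" "u = (\<lambda>x. - lower_envelope B (real n) (\<lambda>z. - g z) x)"
      by (auto simp: I_def)
    then have "(real n)-lipschitz_on UNIV (lower_envelope B (real n) g)"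
      "(real n)-lipschitz_on UNIV (lower_envelope B (real n) (\<lambda>z. - g z))"
      by (auto intro!: lipschitz_lower_envelope)
    then show "(\<exists>L. L-lipschitz_on UNIV l) \<and> (\<exists>L. L-lipschitz_on UNIV u)"
      unfolding lu using lipschitz_on_minus by blast
  next
    fix x assume "lipschitz_at g x"
    then obtain L where "\<forall>\<^sub>F z in nhds x. dist (g z) (g x) \<le> L * dist z x"
      by (auto simp: lipschitz_at_def)
    then obtain S where S: "open S" "x \<in> S" "\<And>z. z \<in> S \<Longrightarrow> dist (g z) (g x) \<le> L * dist z x"
      unfolding eventually_nhds by blast
    \<comment> \<open>The unit ball turns the estimate at \<open>x\<close> into boundedness of
      \<open>g\<close> on \<open>B\<close>.\<close>
    then have "open (S \<inter> ball x 1)" "x \<in> S \<inter> ball x 1" by auto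
    then obtain B where B: "B \<in> \<B>" "x \<in> B" "B \<subseteq> S \<inter> ball x 1"
      using topological_basisE[OF \<B>(2)] by metis
    obtain n :: nat where n: "L \<le> real n" using real_arch_simple by blast
    have lip: "\<bar>g z - g x\<bar> \<le> real n * dist z x" if "z \<in> B" for z
    proof -
      have "\<bar>g z - g x\<bar> \<le> L * dist z x" using S(3)[of z] B(3) that by (auto simp: dist_real_def)
      also have "\<dots> \<le> real n * dist z x" using n by (intro mult_right_mono) auto
      finally show ?thesis .
    qed
    have bnd: "\<bar>g z - g x\<bar> \<le> real n" if "z \<in> B" for z
    proof -
      have "real n * dist z x \<le> real n * 1"
        using B(3) that by (intro mult_left_mono) (auto simp: dist_commute)
      with lip[OF that] show ?thesis by simp
    qed
    have bdd: "bdd_below (g ` B)" "bdd_below ((\<lambda>z. - g z) ` B)"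
      using bnd by (force simp: abs_le_iff intro: bdd_belowI2[where m="g x - real n"] bdd_belowI2[where m="- g x - real n"])+
    have "(lower_envelope B (real n) g, \<lambda>x. - lower_envelope B (real n) (\<lambda>z. - g z) x) \<in> I"
      unfolding I_def using B bdd by (intro image_eqI[of _ _ "(B, n)"]) auto
    moreover have "lower_envelope B (real n) g x = g x"
      using lip by (intro lower_envelope_eq B bdd) (auto simp: abs_le_iff algebra_simps)
    moreover have "lower_envelope B (real n) (\<lambda>z. - g z) x = - g x"
      using lip by (intro lower_envelope_eq B bdd) (auto simp: abs_le_iff algebra_simps)
    moreover have "\<forall>\<^sub>F z in nhds x. lower_envelope B (real n) g z \<le> g z \<and> g z \<le> - lower_envelope B (real n) (\<lambda>z. - g z) z"
    proof -
      have "\<forall>\<^sub>F z in nhds x. z \<in> B"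
        using topological_basis_open[OF \<B>(2) B(1)] B(2) by (rule eventually_nhds_in_open)
      then show ?thesis
      proof eventually_elim
        case (elim z)
        then show ?case
          using lower_envelope_le[OF elim bdd(1), of "real n"] lower_envelope_le[OF elim bdd(2), of "real n"] by simp
      qed
    qed
    ultimately show "\<exists>(l, u)\<in>I. l x = g x \<and> u x = g x \<and> (\<forall>\<^sub>F z in nhds x. l z \<le> g z \<and> g z \<le> u z)"
      by (intro bexI) auto
  qed
qed

section \<open>Differentiability by squeezing\<close>

lemma has_derivative_squeeze:
  fixes g :: "'a::real_normed_vector \<Rightarrow> real"
  assumes l: "(l has_derivative T) (at x)" and u: "u differentiable (at x)"
    and eq: "l x = g x" "u x = g x" and le: "\<forall>\<^sub>F z in nhds x. l z \<le> g z \<and> g z \<le> u z"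
  shows "(u has_derivative T) (at x)" "(g has_derivative T) (at x)"
proof -
  obtain T' where T': "(u has_derivative T') (at x)" using u by (auto simp: differentiable_def)
  have ev: "\<forall>\<^sub>F z in at x. l z \<le> g z \<and> g z \<le> u z"
    using le by (simp add: eventually_nhds_conv_at)
  have "((\<lambda>z. u z - l z) has_derivative (\<lambda>v. T' v - T v)) (at x)"
    by (intro has_derivative_diff T' l)
  \<comment> \<open>\<open>u - l\<close> is nonnegative near \<open>x\<close> and 0 at
    \<open>x\<close>, so its derivative there vanishes.\<close>
  then have "(\<lambda>v. T' v - T v) = (\<lambda>v. 0)"
  proof (rule has_derivative_local_min)
    show "\<forall>\<^sub>F z in at x. u x - l x \<le> u z - l z"
      using ev by eventually_elim (auto simp: eq)
  qed
  then have "T' = T" by (auto simp: fun_eq_iff)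
  with T' show u': "(u has_derivative T) (at x)" by simp
  show "(g has_derivative T) (at x)"
    unfolding has_derivative_within_alt2
  proof (intro conjI allI impI)
    show "bounded_linear T" using l by (rule has_derivative_bounded_linear)
    fix e :: real assume "e > 0"
    with l u' have "\<forall>\<^sub>F z in at x. norm (l z - l x - T (z - x)) \<le> e * norm (z - x)"
      "\<forall>\<^sub>F z in at x. norm (u z - u x - T (z - x)) \<le> e * norm (z - x)"
      unfolding has_derivative_within_alt2 by auto
    with ev show "\<forall>\<^sub>F z in at x. norm (g z - g x - T (z - x)) \<le> e * norm (z - x)"
      by eventually_elim (auto simp: eq abs_le_iff)
  qed
qed

text \<open>Rademacher's theorem is applied to every envelope of the countable family; outside one
  null set, all of them are differentiable, and the pair touching \<open>g\<close> at
  \<open>x\<close> squeezes it.\<close>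

theorem Stepanov:
  fixes g :: "'a::euclidean_space \<Rightarrow> real"
  assumes "AE x in lborel. lipschitz_at g x"
  shows "AE x in lborel. g differentiable (at x)"
proof -
  obtain I where I: "countable I"
    "\<And>l u. (l, u) \<in> I \<Longrightarrow> (\<exists>L. L-lipschitz_on UNIV l) \<and> (\<exists>L. L-lipschitz_on UNIV u)"
    "\<And>x. lipschitz_at g x \<Longrightarrow> \<exists>(l, u)\<in>I. l x = g x \<and> u x = g x \<and> (\<forall>\<^sub>F z in nhds x. l z \<le> g z \<and> g z \<le> u z)"
    by (rule countable_lipschitz_envelopes[of g]) (rule that)
  have "AE x in lborel. \<forall>i\<in>I. fst i differentiable (at x) \<and> snd i differentiable (at x)"
  proof (intro AE_ball_countable' I(1))
    fix i assume "i \<in> I"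
    then obtain L L' where "L-lipschitz_on UNIV (fst i)" "L'-lipschitz_on UNIV (snd i)"
      using I(2)[of "fst i" "snd i"] by auto
    then show "AE x in lborel. fst i differentiable (at x) \<and> snd i differentiable (at x)"
      using Rademacher[of L "fst i"] Rademacher[of L' "snd i"] by auto
  qed
  with assms show ?thesis
  proof eventually_elim
    case (elim x)
    from I(3)[OF elim(1)] obtain l u where lu: "(l, u) \<in> I" "l x = g x" "u x = g x"
      "\<forall>\<^sub>F z in nhds x. l z \<le> g z \<and> g z \<le> u z" by auto
    with elim(2) obtain T where "(l has_derivative T) (at x)" "u differentiable (at x)"
      by (force simp: differentiable_def)
    from has_derivative_squeeze(2)[OF this lu(2-4)] show ?case by (rule differentiableI)
  qed
qed

section \<open>The chain rule for directional derivatives\<close>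

lemma lipschitz_at_of_differentiable:
  assumes "f differentiable (at x)"
  shows "lipschitz_at f x"
proof -
  obtain T where T: "(f has_derivative T) (at x)" using assms by (auto simp: differentiable_def)
  then obtain K where K: "\<And>v. norm (T v) \<le> norm v * K"
    using bounded_linear.bounded[OF has_derivative_bounded_linear] by blast
  from T obtain d where d: "d > 0" "\<And>y. norm (y - x) < d \<Longrightarrow> norm (f y - f x - T (y - x)) \<le> 1 * norm (y - x)"
    unfolding has_derivative_at_alt using zero_less_one by blast
  have "dist (f y) (f x) \<le> (K + 1) * dist y x" if "dist y x < d" for y
  proof -
    have "norm (f y - f x) \<le> norm (f y - f x - T (y - x)) + norm (T (y - x))"
      by (metis diff_add_cancel norm_triangle_ineq)
    also have "\<dots> \<le> norm (y - x) + norm (y - x) * K"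
      using d(2)[of y] K[of "y - x"] that by (simp add: dist_norm)
    finally show ?thesis by (simp add: dist_norm algebra_simps)
  qed
  with d(1) show ?thesis
    unfolding lipschitz_at_def eventually_nhds_metric by blast
qed

lemma lipschitz_at_compose:
  assumes f: "L-lipschitz_on UNIV f" and h: "lipschitz_at h x"
  shows "lipschitz_at (f \<circ> h) x"
proof -
  obtain K where "\<forall>\<^sub>F z in nhds x. dist (h z) (h x) \<le> K * dist z x" using h by (auto simp: lipschitz_at_def)
  then have "\<forall>\<^sub>F z in nhds x. dist ((f \<circ> h) z) ((f \<circ> h) x) \<le> (L * K) * dist z x"
  proof eventually_elim
    case (elim z)
    have "dist (f (h z)) (f (h x)) \<le> L * dist (h z) (h x)" by (rule lipschitz_onD[OF f]) auto
    also have "\<dots> \<le> L * (K * dist z x)" using elim lipschitz_on_nonneg[OF f] by (intro mult_left_mono)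
    finally show ?case by (simp add: ac_simps)
  qed
  then show ?thesis unfolding lipschitz_at_def by blast
qed

lemma has_derivative_imp_has_dir_deriv:
  assumes "(f has_derivative T) (at x)"
  shows "has_dir_deriv f x u (T u)"
proof -
  have "((\<lambda>t. f (x + t *\<^sub>R u)) has_derivative (\<lambda>t. T (t *\<^sub>R u))) (at 0)"
    by (rule has_derivative_compose[of "\<lambda>t. x + t *\<^sub>R u" _ 0 UNIV f T]) (auto intro!: derivative_eq_intros assms)
  then show ?thesis
    unfolding has_derivative_at_alt has_dir_deriv_alt
    using linear_scale[OF bounded_linear.linear[OF has_derivative_bounded_linear[OF assms]]] by simp
qed

text \<open>The curve \<open>h (x + t *\<^sub>R u)\<close> and its tangent line are o(t) apart,
  hence so are the values of \<open>f\<close> on them. Two points other than \<open>h x\<close> are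
  compared, which \<open>lipschitz_at f (h x)\<close> would not control; the lemma is therefore
  applied to the envelopes.\<close>

lemma has_dir_deriv_of_compose:
  fixes f :: "'b::real_normed_vector \<Rightarrow> 'c::real_normed_vector"
  assumes f: "L-lipschitz_on UNIV f" and h: "has_dir_deriv h x u v" and fh: "has_dir_deriv (f \<circ> h) x u d"
  shows "has_dir_deriv f (h x) v d"
  unfolding has_dir_deriv_alt
proof (intro allI impI)
  fix e :: real assume "e > 0"
  have L: "L \<ge> 0" using lipschitz_on_nonneg[OF f] .
  define \<eta> where "\<eta> = e / (L + 1)"
  have \<eta>: "\<eta> > 0" using \<open>e > 0\<close> L by (simp add: \<eta>_def)
  have \<eta>e: "L * \<eta> + \<eta> = e"
  proof -
    have "\<eta> * (L + 1) = e" using L by (simp add: \<eta>_def)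
    then show ?thesis by (simp add: algebra_simps)
  qed
  obtain d1 where d1: "d1 > 0" "\<And>t. \<bar>t\<bar> < d1 \<Longrightarrow> norm (h (x + t *\<^sub>R u) - h x - t *\<^sub>R v) \<le> \<eta> * \<bar>t\<bar>"
    using has_dir_derivD[OF h \<eta>] by blast
  obtain d2 where d2: "d2 > 0" "\<And>t. \<bar>t\<bar> < d2 \<Longrightarrow> norm ((f \<circ> h) (x + t *\<^sub>R u) - (f \<circ> h) x - t *\<^sub>R d) \<le> \<eta> * \<bar>t\<bar>"
    using has_dir_derivD[OF fh \<eta>] by blast
  have "norm (f (h x + t *\<^sub>R v) - f (h x) - t *\<^sub>R d) \<le> e * \<bar>t\<bar>" if t: "\<bar>t\<bar> < min d1 d2" for t
  proof -
    have "dist (h x + t *\<^sub>R v) (h (x + t *\<^sub>R u)) = norm (h (x + t *\<^sub>R u) - h x - t *\<^sub>R v)"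
      by (simp add: dist_norm norm_minus_commute diff_diff_add)
    also have "\<dots> \<le> \<eta> * \<bar>t\<bar>" using t by (intro d1) auto
    finally have "L * dist (h x + t *\<^sub>R v) (h (x + t *\<^sub>R u)) \<le> L * (\<eta> * \<bar>t\<bar>)"
      using L by (rule mult_left_mono)
    then have 1: "norm (f (h x + t *\<^sub>R v) - f (h (x + t *\<^sub>R u))) \<le> L * (\<eta> * \<bar>t\<bar>)"
      using lipschitz_onD[OF f, of "h x + t *\<^sub>R v" "h (x + t *\<^sub>R u)"] by (simp add: dist_norm)
    have split: "a - b - c = (a - m) + (m - b - c)" for a b c m :: 'c
      by simp
    have "norm (f (h x + t *\<^sub>R v) - f (h x) - t *\<^sub>R d)
        \<le> norm (f (h x + t *\<^sub>R v) - f (h (x + t *\<^sub>R u))) + norm (f (h (x + t *\<^sub>R u)) - f (h x) - t *\<^sub>R d)"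
      by (subst split[where m="f (h (x + t *\<^sub>R u))"]) (rule norm_triangle_ineq)
    also have "\<dots> \<le> L * (\<eta> * \<bar>t\<bar>) + \<eta> * \<bar>t\<bar>"
      using 1 d2(2)[of t] t by simp
    also have "\<dots> = e * \<bar>t\<bar>" unfolding \<eta>e[symmetric] by (simp add: algebra_simps)
    finally show ?thesis .
  qed
  with d1(1) d2(1) show "\<exists>\<delta>>0. \<forall>t. \<bar>t\<bar> < \<delta> \<longrightarrow> norm (f (h x + t *\<^sub>R v) - f (h x) - t *\<^sub>R d) \<le> e * \<bar>t\<bar>"
    by (intro exI[of _ "min d1 d2"]) auto
qed

lemma has_dir_deriv_squeeze:
  fixes g :: "'a::real_normed_vector \<Rightarrow> real"
  assumes l: "has_dir_deriv l x v d" and u: "has_dir_deriv u x v d"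
    and eq: "l x = g x" "u x = g x" and le: "\<forall>\<^sub>F z in nhds x. l z \<le> g z \<and> g z \<le> u z"
  shows "has_dir_deriv g x v d"
  unfolding has_dir_deriv_alt
proof (intro allI impI)
  fix e :: real assume e: "e > 0"
  obtain d1 where d1: "d1 > 0" "\<And>t. \<bar>t\<bar> < d1 \<Longrightarrow> norm (l (x + t *\<^sub>R v) - l x - t *\<^sub>R d) \<le> e * \<bar>t\<bar>"
    using has_dir_derivD[OF l e] by blast
  obtain d2 where d2: "d2 > 0" "\<And>t. \<bar>t\<bar> < d2 \<Longrightarrow> norm (u (x + t *\<^sub>R v) - u x - t *\<^sub>R d) \<le> e * \<bar>t\<bar>"
    using has_dir_derivD[OF u e] by blast
  have "((\<lambda>t. x + t *\<^sub>R v) \<longlongrightarrow> x + 0 *\<^sub>R v) (nhds 0)"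
    by (intro tendsto_intros filterlim_ident)
  then have "\<forall>\<^sub>F t in nhds 0. l (x + t *\<^sub>R v) \<le> g (x + t *\<^sub>R v) \<and> g (x + t *\<^sub>R v) \<le> u (x + t *\<^sub>R v)"
    using le by (auto dest: eventually_compose_filterlim)
  then obtain d3 where d3: "d3 > 0"
    "\<And>t. \<bar>t\<bar> < d3 \<Longrightarrow> l (x + t *\<^sub>R v) \<le> g (x + t *\<^sub>R v) \<and> g (x + t *\<^sub>R v) \<le> u (x + t *\<^sub>R v)"
    unfolding eventually_nhds_metric by auto
  have "norm (g (x + t *\<^sub>R v) - g x - t *\<^sub>R d) \<le> e * \<bar>t\<bar>" if "\<bar>t\<bar> < min d1 (min d2 d3)" for t
    using d1(2)[of t] d2(2)[of t] d3(2)[of t] that by (simp add: eq abs_le_iff)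
  with d1(1) d2(1) d3(1) show "\<exists>\<delta>>0. \<forall>t. \<bar>t\<bar> < \<delta> \<longrightarrow> norm (g (x + t *\<^sub>R v) - g x - t *\<^sub>R d) \<le> e * \<bar>t\<bar>"
    by (intro exI[of _ "min d1 (min d2 d3)"]) auto
qed

text \<open>The quantifiers over \<open>u\<close> and \<open>v\<close> stand inside the
  almost-everywhere statement: null sets are discarded only for \<open>h\<close> and for the
  countably many envelopes, after which all directions are handled at the point
  \<open>x\<close>.\<close>

lemma AE_chain_rule_real:
  fixes h :: "'a::euclidean_space \<Rightarrow> 'b::euclidean_space" and f :: "'b \<Rightarrow> real"
  assumes h: "AE x in lborel. h differentiable (at x)" and f: "\<And>y. lipschitz_at f y"
  shows "AE x in lborel. \<exists>D. ((f \<circ> h) has_derivative D) (at x) \<and>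
    (\<forall>u v. has_dir_deriv h x u v \<longrightarrow> has_dir_deriv f (h x) v (D u))"
proof -
  obtain I where I: "countable I"
    "\<And>l u. (l, u) \<in> I \<Longrightarrow> (\<exists>L. L-lipschitz_on UNIV l) \<and> (\<exists>L. L-lipschitz_on UNIV u)"
    "\<And>y. lipschitz_at f y \<Longrightarrow> \<exists>(l, u)\<in>I. l y = f y \<and> u y = f y \<and> (\<forall>\<^sub>F z in nhds y. l z \<le> f z \<and> f z \<le> u z)"
    by (rule countable_lipschitz_envelopes[of f]) (rule that)
  \<comment> \<open>Where \<open>h\<close> is differentiable, \<open>l \<circ> h\<close> is
    pointwise Lipschitz, so Stepanov's theorem applies to it.\<close>
  have comp: "AE x in lborel. (l \<circ> h) differentiable (at x)" if "L-lipschitz_on UNIV l" for l :: "'b \<Rightarrow> real" and L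
    using h by (intro Stepanov, eventually_elim) (rule lipschitz_at_compose[OF that lipschitz_at_of_differentiable])
  have "AE x in lborel. \<forall>i\<in>I. (fst i \<circ> h) differentiable (at x) \<and> (snd i \<circ> h) differentiable (at x)"
  proof (intro AE_ball_countable' I(1))
    fix i assume "i \<in> I"
    then obtain L L' where "L-lipschitz_on UNIV (fst i)" "L'-lipschitz_on UNIV (snd i)"
      using I(2)[of "fst i" "snd i"] by auto
    then show "AE x in lborel. (fst i \<circ> h) differentiable (at x) \<and> (snd i \<circ> h) differentiable (at x)"
      using comp by auto
  qed
  with h show ?thesis
  proof eventually_elim
    case (elim x)
    from I(3)[OF f, of "h x"] obtain l u where lu: "(l, u) \<in> I" "l (h x) = f (h x)" "u (h x) = f (h x)"
      "\<forall>\<^sub>F z in nhds (h x). l z \<le> f z \<and> f z \<le> u z" by auto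
    obtain L L' where L: "L-lipschitz_on UNIV l" "L'-lipschitz_on UNIV u" using I(2)[OF lu(1)] by auto
    from elim(2) lu(1) obtain D where D: "((l \<circ> h) has_derivative D) (at x)" "(u \<circ> h) differentiable (at x)"
      by (force simp: differentiable_def)
    have "isCont h x" using elim(1) by (rule differentiable_imp_continuous_within)
    then have "filterlim h (nhds (h x)) (nhds x)"
      by (simp add: isCont_def tendsto_at_iff_tendsto_nhds)
    then have ev: "\<forall>\<^sub>F z in nhds x. (l \<circ> h) z \<le> (f \<circ> h) z \<and> (f \<circ> h) z \<le> (u \<circ> h) z"
      using lu(4) by (auto dest: eventually_compose_filterlim)
    have D': "((u \<circ> h) has_derivative D) (at x)" "((f \<circ> h) has_derivative D) (at x)"
      using has_derivative_squeeze[OF D _ _ ev] lu(2,3) by (simp_all add: comp_def)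
    have "has_dir_deriv f (h x) w (D v)" if w: "has_dir_deriv h x v w" for v w
      by (rule has_dir_deriv_squeeze[OF _ _ lu(2-4)])
        (intro has_dir_deriv_of_compose[OF L(1) w] has_dir_deriv_of_compose[OF L(2) w] has_derivative_imp_has_dir_deriv D D')+
    with D' show ?case by blast
  qed
qed

lemma has_dir_deriv_componentwise:
  fixes f :: "'a::real_normed_vector \<Rightarrow> 'b::euclidean_space"
  assumes "\<And>b. b \<in> Basis \<Longrightarrow> has_dir_deriv (\<lambda>z. f z \<bullet> b) x v (d \<bullet> b)"
  shows "has_dir_deriv f x v d"
  unfolding has_dir_deriv_def
  by (subst tendsto_componentwise_iff) (use assms in \<open>auto simp: has_dir_deriv_def inner_diff_left\<close>)

text \<open>The real case is applied to the finitely many components of \<open>f\<close>, and the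
  derivative is reassembled from theirs.\<close>

theorem AE_chain_rule:
  fixes h :: "'a::euclidean_space \<Rightarrow> 'b::euclidean_space" and f :: "'b \<Rightarrow> 'c::euclidean_space"
  assumes h: "AE x in lborel. h differentiable (at x)" and f: "\<And>y. lipschitz_at f y"
  shows "AE x in lborel. \<exists>D. ((f \<circ> h) has_derivative D) (at x) \<and>
    (\<forall>u v. has_dir_deriv h x u v \<longrightarrow> has_dir_deriv f (h x) v (D u))"
proof -
  have "lipschitz_at (\<lambda>y. f y \<bullet> b) y" if "b \<in> Basis" for b y
  proof -
    obtain L where "\<forall>\<^sub>F z in nhds y. dist (f z) (f y) \<le> L * dist z y"
      using f[of y] by (auto simp: lipschitz_at_def)
    then have "\<forall>\<^sub>F z in nhds y. dist (f z \<bullet> b) (f y \<bullet> b) \<le> L * dist z y"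
    proof eventually_elim
      case (elim z)
      have "dist (f z \<bullet> b) (f y \<bullet> b) \<le> dist (f z) (f y)"
        using Basis_le_norm[OF that, of "f z - f y"] by (simp add: dist_norm inner_diff_left)
      also note elim
      finally show ?case .
    qed
    then show ?thesis
      unfolding lipschitz_at_def by blast
  qed
  then have "AE x in lborel. \<forall>b\<in>Basis. \<exists>D. (((\<lambda>y. f y \<bullet> b) \<circ> h) has_derivative D) (at x) \<and>
    (\<forall>u v. has_dir_deriv h x u v \<longrightarrow> has_dir_deriv (\<lambda>y. f y \<bullet> b) (h x) v (D u))"
    by (intro AE_ball_countable' AE_chain_rule_real[OF h] countable_finite) auto
  then show ?thesis
  proof eventually_elim
    case (elim x)
    then obtain D where D: "\<And>b. b \<in> Basis \<Longrightarrow> ((\<lambda>z. f (h z) \<bullet> b) has_derivative D b) (at x)"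
      "\<And>b u v. b \<in> Basis \<Longrightarrow> has_dir_deriv h x u v \<Longrightarrow> has_dir_deriv (\<lambda>y. f y \<bullet> b) (h x) v (D b u)"
      unfolding comp_def by metis
    define E where "E u = (\<Sum>b\<in>Basis. D b u *\<^sub>R b)" for u
    have E: "E u \<bullet> b = D b u" if "b \<in> Basis" for u b
      using that by (simp add: E_def)
    have "((f \<circ> h) has_derivative E) (at x)"
      by (subst has_derivative_componentwise_within) (auto simp: E D)
    moreover have "has_dir_deriv f (h x) v (E u)" if "has_dir_deriv h x u v" for u v
      by (rule has_dir_deriv_componentwise) (simp only: E D(2)[OF _ that])
    ultimately show ?case by (intro exI[of _ E]) simp
  qed
qed

section \<open>Limits superior and partial derivatives\<close>

lemma pointwise_lipschitz_imp_lipschitz_at: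
  assumes "pointwise_lipschitz f"
  shows "lipschitz_at f y"
proof -
  have "Limsup (at y) (\<lambda>x. ereal (norm (f x - f y) / norm (x - y))) < \<infinity>"
    using assms by (simp add: pointwise_lipschitz_def)
  then obtain C where "Limsup (at y) (\<lambda>x. ereal (norm (f x - f y) / norm (x - y))) < ereal C"
    using ereal_dense2 by blast
  then have "\<forall>\<^sub>F x in at y. ereal (norm (f x - f y) / norm (x - y)) < ereal C"
    by (rule Limsup_lessD)
  \<comment> \<open>The punctured neighbourhood may be filled in, since at \<open>x = y\<close> both
    distances vanish.\<close>
  then have "\<forall>\<^sub>F x in nhds y. x \<noteq> y \<longrightarrow> norm (f x - f y) / norm (x - y) < C"
    by (simp add: eventually_at_filter)
  then have "\<forall>\<^sub>F x in nhds y. dist (f x) (f y) \<le> C * dist x y"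
  proof eventually_elim
    case (elim x)
    then show ?case by (cases "x = y") (auto simp: dist_norm divide_less_eq)
  qed
  then show ?thesis unfolding lipschitz_at_def by blast
qed

lemma dir_differentiableI: "has_dir_deriv f y v d \<Longrightarrow> dir_differentiable f y v"
  by (auto simp: dir_differentiable_def)

text \<open>Varying the \<open>i\<close>-th coordinate is motion along \<open>axis i 1\<close>, with
  the parameter shifted by \<open>x $ i\<close>.\<close>

lemma coord_section_has_vector_derivative:
  assumes "has_dir_deriv g x (axis i 1) d"
  shows "(coord_section g x i has_vector_derivative d) (at (x $ i))"
proof -
  have sec: "(\<chi> j. if j = i then s else x $ j) = x + (s - x $ i) *\<^sub>R axis i 1" for s
    by (simp add: vec_eq_iff axis_def)
  show ?thesis
    unfolding has_vector_derivative_def has_derivative_at_alt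
  proof (intro conjI allI impI)
    fix e :: real assume "e > 0"
    then obtain \<delta> where \<delta>: "\<delta> > 0" "\<And>t. \<bar>t\<bar> < \<delta> \<Longrightarrow> norm (g (x + t *\<^sub>R axis i 1) - g x - t *\<^sub>R d) \<le> e * \<bar>t\<bar>"
      using has_dir_derivD[OF assms] by blast
    then show "\<exists>\<delta>>0. \<forall>y. norm (y - x $ i) < \<delta> \<longrightarrow>
        norm (coord_section g x i y - coord_section g x i (x $ i) - (y - x $ i) *\<^sub>R d) \<le> e * norm (y - x $ i)"
      by (intro exI[of _ \<delta>]) (simp add: coord_section_def sec)
  qed (rule bounded_linear_scaleR_left)
qed

lemma partial_derivI:
  assumes "has_dir_deriv g x (axis i 1) d"
  shows "partially_differentiable g x i" "partial_deriv g x i = d"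
  using coord_section_has_vector_derivative[OF assms]
  by (auto simp: partially_differentiable_def partial_deriv_def vector_derivative_at
      intro: differentiableI_vector)

theorem theorem2p12:
  fixes h :: "real ^ 'n \<Rightarrow> real ^ 'k" and f :: "real ^ 'k \<Rightarrow> real ^ 'm"
  assumes h_diff: "AE x in lebesgue. h differentiable (at x)"
    and f_lip: "pointwise_lipschitz f"
  shows "(AE x in lebesgue.
            (f \<circ> h) differentiable (at x) \<and>
            (\<forall>u. dir_differentiable h x u \<and>
                 dir_differentiable (f \<circ> h) x u \<and>
                 dir_differentiable f (h x) (dir_deriv h x u) \<and>
                 dir_deriv (f \<circ> h) x u = dir_deriv f (h x) (dir_deriv h x u))) \<and>
         (AE x in lebesgue.
            (\<forall>i. partially_differentiable h x i \<and>
                 partially_differentiable (f \<circ> h) x i \<and>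
                 dir_differentiable f (h x) (partial_deriv h x i) \<and>
                 partial_deriv (f \<circ> h) x i = dir_deriv f (h x) (partial_deriv h x i)))"
proof -
  \<comment> \<open>Completing a measure does not change which properties hold almost everywhere, so
    the argument runs over \<open>lborel\<close> and returns to \<open>lebesgue\<close> at the
    end.\<close>
  have h: "AE x in lborel. h differentiable (at x)"
    using h_diff by (simp add: AE_completion_iff)
  \<comment> \<open>\<open>A\<close> and \<open>D\<close> are the derivatives of \<open>h\<close>
    and \<open>f \<circ> h\<close> at \<open>x\<close>. Since \<open>has_dir_deriv\<close> records
    existence and value together, both halves of the theorem can be read off, the second with
    \<open>u = axis i 1\<close>.\<close>
  have "AE x in lborel. \<exists>A D. ((f \<circ> h) has_derivative D) (at x) \<and>
      (\<forall>u. has_dir_deriv h x u (A u) \<and> has_dir_deriv (f \<circ> h) x u (D u) \<and> has_dir_deriv f (h x) (A u) (D u))"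
    using h AE_chain_rule[OF h pointwise_lipschitz_imp_lipschitz_at[OF f_lip]]
  proof eventually_elim
    case (elim x)
    from elim(1) obtain A where A: "(h has_derivative A) (at x)" by (auto simp: differentiable_def)
    from elim(2) obtain D where D: "((f \<circ> h) has_derivative D) (at x)"
      "\<And>u v. has_dir_deriv h x u v \<Longrightarrow> has_dir_deriv f (h x) v (D u)" by blast
    show ?case
    proof (intro exI[of _ A] exI[of _ D] conjI allI)
      fix u
      show hA: "has_dir_deriv h x u (A u)" by (rule has_derivative_imp_has_dir_deriv[OF A])
      show "has_dir_deriv (f \<circ> h) x u (D u)" by (rule has_derivative_imp_has_dir_deriv[OF D(1)])
      show "has_dir_deriv f (h x) (A u) (D u)" by (rule D(2)[OF hA])
    qed (rule D(1))
  qed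
  then have chain: "AE x in lebesgue. \<exists>A D. ((f \<circ> h) has_derivative D) (at x) \<and>
      (\<forall>u. has_dir_deriv h x u (A u) \<and> has_dir_deriv (f \<circ> h) x u (D u) \<and> has_dir_deriv f (h x) (A u) (D u))"
    by (rule AE_completion)
  show ?thesis
  proof
    from chain show "AE x in lebesgue.
            (f \<circ> h) differentiable (at x) \<and>
            (\<forall>u. dir_differentiable h x u \<and>
                 dir_differentiable (f \<circ> h) x u \<and>
                 dir_differentiable f (h x) (dir_deriv h x u) \<and>
                 dir_deriv (f \<circ> h) x u = dir_deriv f (h x) (dir_deriv h x u))"
    proof eventually_elim
      case (elim x)
      then obtain A D where D: "((f \<circ> h) has_derivative D) (at x)"
        and dirs: "\<And>u. has_dir_deriv h x u (A u)" "\<And>u. has_dir_deriv (f \<circ> h) x u (D u)"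
          "\<And>u. has_dir_deriv f (h x) (A u) (D u)" by blast
      show ?case
        unfolding dir_deriv_eq[OF dirs(1)] dir_deriv_eq[OF dirs(2)] dir_deriv_eq[OF dirs(3)]
        by (intro allI conjI refl differentiableI[OF D] dir_differentiableI[OF dirs(1)]
            dir_differentiableI[OF dirs(2)] dir_differentiableI[OF dirs(3)])
    qed
    from chain show "AE x in lebesgue.
            (\<forall>i. partially_differentiable h x i \<and>
                 partially_differentiable (f \<circ> h) x i \<and>
                 dir_differentiable f (h x) (partial_deriv h x i) \<and>
                 partial_deriv (f \<circ> h) x i = dir_deriv f (h x) (partial_deriv h x i))"
    proof eventually_elim
      case (elim x)
      then obtain A D where
        dirs: "\<And>u. has_dir_deriv h x u (A u)" "\<And>u. has_dir_deriv (f \<circ> h) x u (D u)"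
          "\<And>u. has_dir_deriv f (h x) (A u) (D u)" by blast
      show ?case
        unfolding partial_derivI(2)[OF dirs(1)] partial_derivI(2)[OF dirs(2)] dir_deriv_eq[OF dirs(3)]
        by (intro allI conjI refl partial_derivI(1)[OF dirs(1)] partial_derivI(1)[OF dirs(2)]
            dir_differentiableI[OF dirs(3)])
    qed
  qed
qed

end
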